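(* Let $q$ be a power of an odd prime $p$, let $n\ge 1$, and let $f(x)\in\mathbb{F}_{q^n}[x]$ be a cubic polynomial with distinct roots. Then the elliptic curve $(t^{q^n}-t)y^2=f(x)$ over $\mathbb{F}_{q^n}(t)$ has a point $(F(t),G(t))$ with $F,G\in\mathbb{F}_{q^n}[t]$ satisfying $F'(t)\neq 0$ and $2\deg F(t)\le q^n-1$ if and only if $p\equiv 3\pmod 4$ and the curve $y^2=f(x)$ is isomorphic over $\mathbb{F}_{q^n}$ to $ay^2=x^3-x$ for some $a\in\mathbb{F}_{q^n}$.
   Context: $F'(t)$ denotes the formal derivative of $F$ with respect to $t$. *)

theory Defs
  imports
    "HOL-Library.Cardinality"
    "HOL-Number_Theory.Cong"
    "HOL-Algebra.Algebraic_Closure_Type"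
    "HOL-Computational_Algebra.Polynomial_Factorial"
begin

text \<open>
  Throughout, \<open>d\<close> and \<open>f\<close> are the data of the curve \<open>d y\<^sup>2 = f(x)\<close>, with \<open>d \<noteq> 0\<close> and
  \<open>f\<close> a cubic with distinct roots.
\<close>

definition affine_points :: "'k::field \<Rightarrow> 'k poly \<Rightarrow> ('k \<times> 'k) set" where
  "affine_points d f = {(x, y). d * y ^ 2 = poly f x}"

text \<open>The constants of the rational function field \<open>k(t)\<close>.\<close>

definition const_fract :: "'a::field \<Rightarrow> 'a poly fract" where
  "const_fract c = to_fract [:c:]"

text \<open>
  A point \<open>[x : y : z]\<close> of the projective plane is the set of all its homogeneous coordinate
  vectors; this is meaningful for \<open>(x, y, z) \<noteq> (0, 0, 0)\<close>.
\<close>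

definition hcoord :: "'k::field \<times> 'k \<times> 'k \<Rightarrow> ('k \<times> 'k \<times> 'k) set" where
  "hcoord = (\<lambda>(x, y, z). {(c * x, c * y, c * z) | c. c \<noteq> 0})"

text \<open>
  The projective closure \<open>d Y\<^sup>2 Z = f\<^sub>3 X\<^sup>3 + f\<^sub>2 X\<^sup>2 Z + f\<^sub>1 X Z\<^sup>2 + f\<^sub>0 Z\<^sup>3\<close>, and its
  origin \<open>[0 : 1 : 0]\<close>, the only point with \<open>Z = 0\<close>.
\<close>

definition proj_points :: "'k::field \<Rightarrow> 'k poly \<Rightarrow> ('k \<times> 'k \<times> 'k) set set" where
  "proj_points d f = {hcoord (x, y, z) | x y z. (x, y, z) \<noteq> (0, 0, 0) \<and>
     d * y ^ 2 * z = (\<Sum>i\<le>3. Polynomial.coeff f i * x ^ i * z ^ (3 - i))}"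

definition origin :: "('k::field \<times> 'k \<times> 'k) set" where
  "origin = hcoord (0, 1, 0)"

text \<open>
  A form of degree \<open>m\<close> in \<open>X, Y, Z\<close> over \<open>k\<close> is given by its coefficients: \<open>A i j\<close> belongs to
  \<open>X\<^sup>i Y\<^sup>j Z\<^bsup>m-i-j\<^esup>\<close>, and only the values with \<open>i + j \<le> m\<close> matter. It is evaluated at vectors
  over the algebraic closure of \<open>k\<close>.
\<close>

definition form_eval :: "nat \<Rightarrow> (nat \<Rightarrow> nat \<Rightarrow> 'a::field) \<Rightarrow>
    'a alg_closure \<times> 'a alg_closure \<times> 'a alg_closure \<Rightarrow> 'a alg_closure" where
  "form_eval m A = (\<lambda>(x, y, z).
     \<Sum>i\<le>m. \<Sum>j\<le>m - i. to_ac (A i j) * x ^ i * y ^ j * z ^ (m - i - j))"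

text \<open>
  Morphisms over \<open>k\<close> between projective plane curves, given by their geometric points: around
  every point the map is given by three forms over \<open>k\<close> of equal degree, without common zero at
  that point. As the curves considered here are irreducible, such a triple describes the map at
  all points where the forms do not vanish simultaneously.
\<close>

definition morphism_over :: "('a::field alg_closure \<times> 'a alg_closure \<times> 'a alg_closure) set set \<Rightarrow>
    ('a alg_closure \<times> 'a alg_closure \<times> 'a alg_closure) set set \<Rightarrow>
    (('a alg_closure \<times> 'a alg_closure \<times> 'a alg_closure) set \<Rightarrow>
     ('a alg_closure \<times> 'a alg_closure \<times> 'a alg_closure) set) \<Rightarrow> bool" where
  "morphism_over C D \<phi> \<longleftrightarrow> \<phi> ` C \<subseteq> D \<and>
     (\<forall>P\<in>C. \<exists>m A\<^sub>0 A\<^sub>1 A\<^sub>2.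
        let ev = (\<lambda>v. (form_eval m A\<^sub>0 v, form_eval m A\<^sub>1 v, form_eval m A\<^sub>2 v)) in
        (\<exists>v. P = hcoord v \<and> ev v \<noteq> (0, 0, 0)) \<and>
        (\<forall>v. hcoord v \<in> C \<and> ev v \<noteq> (0, 0, 0) \<longrightarrow> \<phi> (hcoord v) = hcoord (ev v)))"

text \<open>
  Isomorphism over \<open>k\<close> of the elliptic curves \<open>d y\<^sup>2 = f(x)\<close> and \<open>e y\<^sup>2 = g(x)\<close>: mutually inverse
  morphisms over \<open>k\<close> of the projective curves that respect the origins.
\<close>

definition isomorphic_over :: "'a::field \<Rightarrow> 'a poly \<Rightarrow> 'a \<Rightarrow> 'a poly \<Rightarrow> bool" where
  "isomorphic_over d f e g \<longleftrightarrow>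
     (let C = proj_points (to_ac d) (map_poly to_ac f);
          D = proj_points (to_ac e) (map_poly to_ac g)
      in \<exists>\<phi> \<psi>. morphism_over C D \<phi> \<and> morphism_over D C \<psi> \<and>
           (\<forall>P\<in>C. \<psi> (\<phi> P) = P) \<and> (\<forall>Q\<in>D. \<phi> (\<psi> Q) = Q) \<and> \<phi> origin = origin)"

end

theory Submission
  imports Defs "HOL-Number_Theory.Residues"
begin

text \<open>
  Write \<open>Q = q\<^sup>n\<close> and \<open>\<tau> = t\<^sup>Q - t\<close>.  Given a solution, \<open>F\<close> maps the \<open>Q\<close> elements of the field to
  roots of \<open>f\<close>, so \<open>2 deg F < Q\<close> forces \<open>f\<close> to split.  Differentiating \<open>\<tau> G\<^sup>2 = f(F)\<close> gives
  \<open>2 f(F) G' - f'(F) F' G = G\<^sup>3\<close>.  For \<open>f = c (x\<^sup>3 + a x + b)\<close> the part \<open>c F\<^sup>2 (2 F G' - 3 F' G)\<close> of the left-hand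
  side has too large a degree and must vanish; what remains forces \<open>b = 0\<close> and \<open>G\<^sup>2 = 2 c a F'\<close>.
  (In characteristic \<open>3\<close> the same comparison removes the quadratic term of \<open>f\<close>.)  The curve is thus a
  twist of \<open>y\<^sup>2 = x\<^sup>3 - x\<close>; if \<open>p \<equiv> 1 (mod 4)\<close> its Hasse invariant is non-zero, so the Cartier operator is
  bijective on the pull-back \<open>G dt / \<surd>\<tau>\<close> of \<open>dx / y\<close>, whereas its iterates kill all such
  differentials of small degree.

  Conversely, an isomorphism over the field is an affine substitution in \<open>x\<close> with coefficients fixed
  by the Frobenius map, and \<open>T \<circ> \<mu>t\<close>, for \<open>T\<close> the trace polynomial, gives a solution \<open>T\<^sup>(\<^sup>p\<^sup>-\<^sup>1\<^sup>)\<^sup>/\<^sup>2\<close>.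
\<close>

section \<open>Derivatives in characteristic \<open>p\<close>\<close>

text \<open>That \<open>f\<close> splits is needed in its own right: for p \<noteq> 3 the
  differential equation only yields \<open>x^3 + a x\<close> up to translation and scaling, possibly
  a quartic twist, and a further root of \<open>f\<close> makes \<open>- a\<close> a square. Since 3
  is itself congruent to 3 modulo 4, characteristic 3 needs only the shape of \<open>f\<close>. The
  Cartier operator is represented by \<open>pderiv ^^ (p - 1)\<close>, which sends \<open>g\<close>
  to minus the p-th power of the coefficient of the image of \<open>g dt\<close>; thus no p-th roots
  are taken. The solution in the other direction comes from the prime field: x = t^((p-1)/2) gives
  x^3 - x = t^((p-3)/2) (t^p - t), where (p-3)/2 is even exactly for p congruent to 3 modulo 4.
  Substituting \<open>T\<close> for t reduces the general case to this one. Isomorphisms are given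
  only as maps on geometric points, described locally by forms. Their affine coordinates must first
  be shown to be polynomial; pole orders at the origin then bound the degrees, and commutation with
  Frobenius recovers the field of definition.\<close>

lemma higher_pderiv_const_mult:
  fixes h g :: "'a::field poly"
  assumes "pderiv h = 0"
  shows "(pderiv ^^ n) (h * g) = h * (pderiv ^^ n) g"
  by (induction n) (simp_all add: pderiv_mult assms)

lemma pderiv_power_CHAR:
  fixes h :: "'a::field poly"
  assumes "CHAR('a) = p"
  shows "pderiv (h ^ p) = 0"
proof -
  have "of_nat p = (0::'a)" using assms of_nat_CHAR by metis
  then show ?thesis by (cases p) (simp_all add: pderiv_power_Suc pderiv_1 del: of_nat_Suc power_Suc)
qed

text \<open>Each coefficient is multiplied by \<open>p\<close> consecutive integers, a product equal
  to \<open>fact p\<close> times a binomial coefficient.\<close>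

lemma higher_pderiv_CHAR:
  fixes g :: "'a::field poly"
  assumes "CHAR('a) = p" "p > 0"
  shows "(pderiv ^^ p) g = 0"
proof (rule poly_eqI)
  fix n
  have *: "pochhammer (of_nat (Suc n)) p = (of_nat (pochhammer (Suc n) p) :: 'a)"
    by (simp add: pochhammer_of_nat del: of_nat_Suc)
  have "p dvd pochhammer (Suc n) p"
  proof -
    have "fact (n + p) = fact n * pochhammer (Suc n) p"
      using pochhammer_product'[of "1::nat" n p] by (simp only: pochhammer_fact[symmetric] of_nat_id plus_1_eq_Suc)
    moreover have "fact p * fact n * ((n + p) choose p) = fact (n + p)"
      using binomial_fact_lemma[of p "n + p"] by simp
    ultimately have "fact n * pochhammer (Suc n) p = fact n * (fact p * ((n + p) choose p))"
      by (simp only: ac_simps)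
    then have "pochhammer (Suc n) p = fact p * ((n + p) choose p)"
      by (simp only: mult_cancel_left fact_nonzero simp_thms)
    moreover have "p dvd fact p" using assms(2) by (simp add: dvd_fact)
    ultimately show ?thesis by simp
  qed
  then have "(of_nat (pochhammer (Suc n) p) :: 'a) = 0"
    using assms(1) of_nat_eq_0_iff_char_dvd by blast
  then show "Polynomial.coeff ((pderiv ^^ p) g) n = Polynomial.coeff 0 n"
    by (simp only: coeff_higher_pderiv * mult_zero_left coeff_0)
qed

text \<open>The argument is itself a derivative, because \<open>Suc j\<close> is invertible, so
  \<open>p\<close> derivatives are taken in all. This is the fact that the Cartier operator kills
  exact differentials.\<close>

lemma higher_pderiv_power_mult_pderiv_eq_0:
  fixes F :: "'a::field poly"
  assumes "CHAR('a) = p" "p > 0" "\<not> p dvd Suc j"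
  shows "(pderiv ^^ (p - 1)) (F ^ j * pderiv F) = 0"
proof -
  have nz: "of_nat (Suc j) \<noteq> (0::'a)" unfolding of_nat_eq_0_iff_char_dvd assms(1) by (rule assms(3))
  have "pderiv (F ^ Suc j) = smult (of_nat (Suc j)) (F ^ j * pderiv F)"
    by (simp only: pderiv_power_Suc smult_smult mult_smult_left)
  then have "F ^ j * pderiv F = pderiv (smult (inverse (of_nat (Suc j))) (F ^ Suc j))"
    using nz by (simp add: pderiv_smult del: of_nat_Suc power_Suc)
  then have "(pderiv ^^ (p - 1)) (F ^ j * pderiv F)
      = (pderiv ^^ (Suc (p - 1))) (smult (inverse (of_nat (Suc j))) (F ^ Suc j))"
    by (simp only: funpow_Suc_right comp_apply)
  also have "\<dots> = 0" using higher_pderiv_CHAR[OF assms(1,2)] assms(2) by simp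
  finally show ?thesis .
qed

text \<open>
  The formula is stable under products and, because \<open>F ^ i * pderiv F\<close> is a derivative for
  \<open>i < p - 1\<close>, under adding constants to \<open>F\<close>.
\<close>

lemma higher_pderiv_power_mult_pderiv:
  fixes F :: "'a::field poly"
  assumes "CHAR('a) = p" "Factorial_Ring.prime p"
  shows "(pderiv ^^ (p - 1)) (F ^ (p - 1) * pderiv F) = smult (of_nat (fact (p - 1))) (pderiv F ^ p)"
proof -
  \<comment> \<open>By Wilson's theorem this constant is -1; later only its being non-zero
    matters.\<close>
  let ?w = "of_nat (fact (p - 1)) :: 'a"
  define J where "J F \<longleftrightarrow> (pderiv ^^ (p - 1)) (F ^ (p - 1) * pderiv F) = smult ?w (pderiv F ^ p)" for F :: "'a poly"
  have p0: "p > 0" using assms(2) prime_gt_0_nat by blast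
  have Fr: "(x + y) ^ p = x ^ p + y ^ p" for x y :: "'a poly"
    by (rule freshmans_dream) (simp_all add: assms)
  have pw: "x ^ p = x * x ^ (p - 1)" for x :: "'a poly" using p0 by (cases p) auto
  have mult: "J (F * H)" if "J F" "J H" for F H
  proof -
    \<comment> \<open>The product rule leaves p-th powers of \<open>F\<close> and \<open>H\<close>
      as coefficients, and these pass through derivatives like constants.\<close>
    have "(F * H) ^ (p - 1) * pderiv (F * H)
        = F ^ p * (H ^ (p - 1) * pderiv H) + H ^ p * (F ^ (p - 1) * pderiv F)"
      unfolding pw[of F] pw[of H] by (simp add: pderiv_mult power_mult_distrib algebra_simps)
    then have "(pderiv ^^ (p - 1)) ((F * H) ^ (p - 1) * pderiv (F * H))
        = F ^ p * smult ?w (pderiv H ^ p) + H ^ p * smult ?w (pderiv F ^ p)"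
      using that by (simp add: J_def higher_pderiv_add higher_pderiv_const_mult
        pderiv_power_CHAR[OF assms(1)])
    also have "\<dots> = smult ?w (pderiv (F * H) ^ p)"
      by (simp add: pderiv_mult Fr power_mult_distrib smult_add_right)
    finally show ?thesis by (simp add: J_def)
  qed
  have add: "J (F + [:a:])" if "J F" for F a
  proof -
    have "(F + [:a:]) ^ (p - 1) * pderiv F
        = (\<Sum>i\<le>p-1. (of_nat ((p - 1) choose i) * [:a:] ^ (p - 1 - i)) * (F ^ i * pderiv F))"
      by (simp add: binomial_ring sum_distrib_left mult_ac)
    also have "(pderiv ^^ (p - 1)) \<dots>
        = (\<Sum>i\<le>p-1. (of_nat ((p - 1) choose i) * [:a:] ^ (p - 1 - i)) * (pderiv ^^ (p - 1)) (F ^ i * pderiv F))"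
      unfolding higher_pderiv_sum
      by (intro sum.cong refl higher_pderiv_const_mult)
        (simp add: poly_const_pow pderiv_smult of_nat_poly pderiv_pCons)
    also have "\<dots> = (\<Sum>i\<in>{p-1}. (of_nat ((p - 1) choose i) * [:a:] ^ (p - 1 - i)) * (pderiv ^^ (p - 1)) (F ^ i * pderiv F))"
    proof (intro sum.mono_neutral_right ballI)
      fix i assume "i \<in> {..p-1} - {p-1}"
      then have "\<not> p dvd Suc i" using p0 by (auto dest!: dvd_imp_le)
      then show "(of_nat ((p - 1) choose i) * [:a:] ^ (p - 1 - i)) * (pderiv ^^ (p - 1)) (F ^ i * pderiv F) = 0"
        using higher_pderiv_power_mult_pderiv_eq_0[OF assms(1) p0] by simp
    qed auto
    finally show ?thesis using that by (simp add: J_def pderiv_add pderiv_pCons)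
  qed
  have X: "J [:0, 1:]"
  proof -
    have "(pderiv ^^ (p - 1)) ([:0, 1:] ^ (p - 1)) = [:?w:]"
    proof (rule poly_eqI)
      fix n
      have "pochhammer 1 (p - 1) = ?w"
        using pochhammer_of_nat[of 1 "p - 1", where 'a = 'a] by (simp add: pochhammer_fact)
      then show "Polynomial.coeff ((pderiv ^^ (p - 1)) ([:0, 1::'a:] ^ (p - 1))) n = Polynomial.coeff [:?w:] n"
        by (cases n) (simp_all add: coeff_higher_pderiv coeff_linear_power monom_altdef[symmetric, of 1, simplified] coeff_pCons)
    qed
    then show ?thesis by (simp add: J_def pderiv_pCons poly_const_pow)
  qed
  have "J F"
  proof (induction F)
    case 0
    then show ?case using p0 by (simp add: J_def)
  next
    case (pCons a F)
    have "pCons a F = [:0, 1:] * F + [:a:]" by simp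
    then show ?case using add mult X pCons.IH by metis
  qed
  then show ?thesis by (simp add: J_def)
qed

text \<open>The p-th power map acts monomial by monomial, so exponents are multiplied by
  \<open>p\<close> and never collide.\<close>

lemma coeff_power_CHAR:
  fixes G :: "'a::field poly"
  assumes "CHAR('a) = p" "Factorial_Ring.prime p"
  shows "Polynomial.coeff (G ^ p) (p * m) = Polynomial.coeff G m ^ p"
proof -
  have p0: "p > 0" using assms(2) prime_gt_0_nat by blast
  have "G ^ p = (\<Sum>i\<le>Polynomial.degree G. Polynomial.monom (Polynomial.coeff G i) i) ^ p"
    by (simp add: poly_as_sum_of_monoms)
  also have "\<dots> = (\<Sum>i\<le>Polynomial.degree G. Polynomial.monom (Polynomial.coeff G i) i ^ p)"
    by (rule freshmans_dream_sum) (simp_all add: assms)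
  also have "Polynomial.coeff \<dots> (p * m)
      = (\<Sum>i\<le>Polynomial.degree G. if i = m then Polynomial.coeff G i ^ p else 0)"
    using p0 by (auto simp: coeff_sum monom_power intro!: sum.cong)
  also have "\<dots> = Polynomial.coeff G m ^ p"
    using p0 by (auto simp: sum.delta coeff_eq_0)
  finally show ?thesis .
qed

text \<open>
  This is the Cartier operator applied to \<open>y\<^sup>p\<^sup>-\<^sup>1 dx\<close> on \<open>y\<^sup>2 = x\<^sup>3 + a x\<close>: of the expansion only the Hasse
  coefficient, that of \<open>H ^ (p - 1)\<close>, survives, and it is non-zero because \<open>p \<equiv> 1 (mod 4)\<close>.
\<close>

lemma higher_pderiv_Hasse:
  fixes H :: "'a::field poly"
  assumes "CHAR('a) = p" "Factorial_Ring.prime p" "p = 4 * l + 1"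
  shows "(pderiv ^^ (p - 1)) (H ^ (2 * l) * (H\<^sup>2 + [:a:]) ^ (2 * l) * pderiv H)
    = smult (of_nat ((2 * l) choose l) * a ^ l * of_nat (fact (p - 1))) (pderiv H ^ p)"
proof -
  have p0: "p > 0" using assms(3) by simp
  let ?c = "\<lambda>i. smult (of_nat ((2 * l) choose i) * a ^ (2 * l - i))"
  have binom: "(H\<^sup>2 + [:a:]) ^ n = (\<Sum>i\<le>n. smult (of_nat (n choose i) * a ^ (n - i)) ((H\<^sup>2) ^ i))" for n
    by (simp add: binomial_ring poly_const_pow of_nat_poly mult.commute)
  have expand: "H ^ (2 * l) * (H\<^sup>2 + [:a:]) ^ (2 * l) * pderiv H
      = (\<Sum>i\<le>2*l. ?c i (H ^ (2 * l + 2 * i) * pderiv H))"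
    unfolding binom sum_distrib_left sum_distrib_right
    by (intro sum.cong refl) (simp only: power_add power_mult[symmetric] mult_smult_left mult_smult_right mult.assoc)
  have "(pderiv ^^ (p - 1)) (H ^ (2 * l) * (H\<^sup>2 + [:a:]) ^ (2 * l) * pderiv H)
      = (\<Sum>i\<le>2*l. ?c i ((pderiv ^^ (p - 1)) (H ^ (2 * l + 2 * i) * pderiv H)))"
    by (simp only: expand higher_pderiv_sum higher_pderiv_smult)
  also have "\<dots> = (\<Sum>i\<in>{l}. ?c i ((pderiv ^^ (p - 1)) (H ^ (2 * l + 2 * i) * pderiv H)))"
  proof (intro sum.mono_neutral_right ballI)
    fix i assume i: "i \<in> {..2*l} - {l}"
    \<comment> \<open>The number is positive and at most \<open>6 * l + 1\<close>, which is below
      \<open>2 * p\<close>; it could only be \<open>p\<close> itself, which happens for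
      \<open>i = l\<close>.\<close>
    have "\<not> p dvd Suc (2 * l + 2 * i)"
    proof
      assume "p dvd Suc (2 * l + 2 * i)"
      then obtain k where k: "Suc (2 * l + 2 * i) = (4 * l + 1) * k" using assms(3) by (auto elim: dvdE)
      have "(4 * l + 1) * k < (4 * l + 1) * 2" using k i by simp
      then have "k < 2" by (simp only: mult_less_cancel1)
      then have "k = 0 \<or> k = 1" by auto
      then show False using k i by auto
    qed
    then show "?c i ((pderiv ^^ (p - 1)) (H ^ (2 * l + 2 * i) * pderiv H)) = 0"
      using higher_pderiv_power_mult_pderiv_eq_0[OF assms(1) p0] by simp
  qed auto
  also have "\<dots> = smult (of_nat ((2 * l) choose l) * a ^ l) ((pderiv ^^ (p - 1)) (H ^ (p - 1) * pderiv H))"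
  proof -
    have "2 * l + 2 * l = p - 1" "2 * l - l = l" using assms(3) by auto
    then show ?thesis by (simp only: sum.insert sum.empty finite.emptyI empty_iff simp_thms add_0_right)
  qed
  finally show ?thesis
    by (simp only: higher_pderiv_power_mult_pderiv[OF assms(1,2)] smult_smult)
qed

text \<open>Since \<open>4 * l + 2 = p + 1\<close>, the power \<open>2 * l\<close> of the curve
  equation times \<open>pderiv H\<close> is \<open>G ^ p\<close> times
  \<open>G * \<tau> ^ (2 * l)\<close>, up to constants. Applying \<open>pderiv ^^ (p - 1)\<close>
  and cancelling \<open>G ^ p\<close> leaves a non-zero multiple of \<open>G ^ p\<close>, whose
  coefficient at \<open>p * m\<close> comes from that of \<open>G\<close> at
  \<open>m\<close>.\<close>

lemma coeff_Cartier:
  fixes H G :: "'a::field poly"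
  assumes p: "CHAR('a) = p" "Factorial_Ring.prime p" "p = 4 * l + 1"
    and eq: "\<tau> * G\<^sup>2 = smult c (H * (H\<^sup>2 + [:a:]))" and der: "pderiv H = smult \<kappa> (G\<^sup>2)"
    and nz: "c \<noteq> 0" "a \<noteq> 0" "\<kappa> \<noteq> 0" and G: "Polynomial.coeff G m \<noteq> 0"
  shows "Polynomial.coeff (G * \<tau> ^ (2 * l)) (p * m + (p - 1)) \<noteq> 0"
proof -
  let ?w = "of_nat ((2 * l) choose l) * a ^ l * of_nat (fact (p - 1)) :: 'a"
  have p0: "p > 0" using p(3) by simp
  have G0: "G \<noteq> 0" using G by auto
  have nzn: "of_nat n \<noteq> (0::'a)" if "\<not> p dvd n" for n
    unfolding of_nat_eq_0_iff_char_dvd p(1) by (rule that)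
  have 1: "\<not> p dvd fact (p - 1)"
    using p(2) p0 by (simp add: prime_dvd_fact_iff)
  have "\<not> p dvd fact (2 * l)"
    using p by (simp add: prime_dvd_fact_iff)
  moreover have "(2 * l) choose l dvd fact (2 * l)"
    by (metis binomial_fact_lemma dvd_triv_right le_add1 mult_2)
  ultimately have 2: "\<not> p dvd ((2 * l) choose l)"
    using dvd_trans by blast
  have Hasse: "(pderiv ^^ (p - 1)) (H ^ (2 * l) * (H\<^sup>2 + [:a:]) ^ (2 * l) * pderiv H) = smult ?w (smult \<kappa> (G\<^sup>2) ^ p)"
    unfolding der[symmetric] by (rule higher_pderiv_Hasse[OF p])
  have w: "?w \<noteq> 0" using nzn[OF 1] nzn[OF 2] nz by simp
  have key: "(\<tau> * G\<^sup>2) ^ P * smult \<kappa> (G\<^sup>2) = smult \<kappa> (G ^ (2 * P + 1) * (G * \<tau> ^ P))" for P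
    by (simp add: power_mult_distrib power_mult power2_eq_square mult_ac)
  have pp: "p = 2 * (2 * l) + 1" using p(3) by simp
  have "smult (c ^ (2 * l)) (H ^ (2 * l) * (H\<^sup>2 + [:a:]) ^ (2 * l) * pderiv H)
      = (smult c (H * (H\<^sup>2 + [:a:]))) ^ (2 * l) * pderiv H"
    by (simp add: smult_power power_mult_distrib)
  also have "\<dots> = (\<tau> * G\<^sup>2) ^ (2 * l) * smult \<kappa> (G\<^sup>2)"
    by (simp only: eq der)
  also have "\<dots> = smult \<kappa> (G ^ p * (G * \<tau> ^ (2 * l)))"
    unfolding pp by (rule key)
  finally have 1: "smult (c ^ (2 * l)) (H ^ (2 * l) * (H\<^sup>2 + [:a:]) ^ (2 * l) * pderiv H)
      = smult \<kappa> (G ^ p * (G * \<tau> ^ (2 * l)))" .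
  have "(pderiv ^^ (p - 1)) (smult (c ^ (2 * l)) (H ^ (2 * l) * (H\<^sup>2 + [:a:]) ^ (2 * l) * pderiv H))
      = (pderiv ^^ (p - 1)) (smult \<kappa> (G ^ p * (G * \<tau> ^ (2 * l))))"
    by (simp only: 1)
  then have "smult (c ^ (2 * l)) (smult ?w (smult \<kappa> (G\<^sup>2) ^ p))
      = smult \<kappa> (G ^ p * (pderiv ^^ (p - 1)) (G * \<tau> ^ (2 * l)))"
    by (simp only: higher_pderiv_smult Hasse
        higher_pderiv_const_mult[OF pderiv_power_CHAR[OF p(1)]])
  then have "G ^ p * smult (c ^ (2 * l) * ?w * \<kappa> ^ p) (G ^ p)
      = G ^ p * smult \<kappa> ((pderiv ^^ (p - 1)) (G * \<tau> ^ (2 * l)))"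
    by (simp add: smult_power power2_eq_square power_mult_distrib mult_ac)
  then have "smult (c ^ (2 * l) * ?w * \<kappa> ^ p) (G ^ p)
      = smult \<kappa> ((pderiv ^^ (p - 1)) (G * \<tau> ^ (2 * l)))"
    using G0 by (simp only: mult_cancel_left power_eq_0_iff) simp
  then have "Polynomial.coeff (smult (c ^ (2 * l) * ?w * \<kappa> ^ p) (G ^ p)) (p * m)
      = Polynomial.coeff (smult \<kappa> ((pderiv ^^ (p - 1)) (G * \<tau> ^ (2 * l)))) (p * m)"
    by (rule arg_cong)
  then have "c ^ (2 * l) * ?w * \<kappa> ^ p * Polynomial.coeff G m ^ p
      = \<kappa> * (pochhammer (of_nat (Suc (p * m))) (p - 1) * Polynomial.coeff (G * \<tau> ^ (2 * l)) (p * m + (p - 1)))"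
    by (simp only: coeff_smult coeff_power_CHAR[OF p(1,2)] coeff_higher_pderiv)
  moreover have "c ^ (2 * l) * ?w * \<kappa> ^ p * Polynomial.coeff G m ^ p \<noteq> 0"
    using w nz G by simp
  ultimately show ?thesis by auto
qed

section \<open>Solutions and twists\<close>

lemma coeff_mult_monom_neq_0:
  assumes "Polynomial.coeff (G * Polynomial.monom c k) N \<noteq> 0"
  shows "\<exists>m. N = m + k \<and> Polynomial.coeff G m \<noteq> 0"
  using assms by (auto simp: coeff_monom_mult mult.commute[of G] intro!: exI[of _ "N - k"] split: if_splits)

text \<open>In the binomial expansion of the power, term \<open>i\<close> is a multiple of
  \<open>t ^ (Q * i + (P - i))\<close>, and some term must contribute.\<close>

lemma coeff_mult_Artin_Schreier_power_neq_0:
  fixes G :: "'a::field poly"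
  assumes "Polynomial.coeff (G * (Polynomial.monom 1 Q - Polynomial.monom 1 1) ^ P) N \<noteq> 0"
  shows "\<exists>i m. i \<le> P \<and> N = m + Q * i + (P - i) \<and> Polynomial.coeff G m \<noteq> 0"
proof -
  have *: "- Polynomial.monom (1::'a) 1 = Polynomial.monom (- 1) 1" by (simp add: minus_monom)
  have "(Polynomial.monom (1::'a) Q - Polynomial.monom 1 1) ^ P
      = (\<Sum>i\<le>P. Polynomial.monom (of_nat (P choose i) * (- 1) ^ (P - i)) (Q * i + (P - i)))"
    unfolding diff_conv_add_uminus * binomial_ring
    by (intro sum.cong refl) (simp add: monom_power mult_monom of_nat_poly flip: monom_0)
  then have "Polynomial.coeff (G * (Polynomial.monom 1 Q - Polynomial.monom 1 1) ^ P) N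
      = (\<Sum>i\<le>P. Polynomial.coeff (G * Polynomial.monom (of_nat (P choose i) * (- 1) ^ (P - i)) (Q * i + (P - i))) N)"
    by (simp only: sum_distrib_left coeff_sum)
  with assms obtain i where "i \<le> P"
    "Polynomial.coeff (G * Polynomial.monom (of_nat (P choose i) * (- 1) ^ (P - i)) (Q * i + (P - i))) N \<noteq> 0"
    by (metis (no_types, lifting) sum.not_neutral_contains_not_neutral atMost_iff)
  with coeff_mult_monom_neq_0 show ?thesis by (metis add.assoc)
qed

lemma degree_pderiv_le: "Polynomial.degree (pderiv G) \<le> Polynomial.degree G - 1"
  by (rule degree_le) (auto simp: coeff_pderiv coeff_eq_0)

text \<open>
  If \<open>m\<close> is in the support of \<open>G\<close>, so is some \<open>m'\<close> with \<open>2 m' + 1 \<equiv> p (2 m + 1) (mod 2 (Q - 1))\<close>.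
  After \<open>r\<close> steps the odd number \<open>2 m + 1\<close> has been shifted by \<open>Q - 1\<close>, too far for the degree of \<open>G\<close>.
\<close>

lemma Artin_Schreier_no_solution_1_mod_4:
  fixes H G :: "'a::field poly"
  assumes p: "CHAR('a) = p" "Factorial_Ring.prime p" "p = 4 * l + 1" and Q: "Q = p ^ r"
    and eq: "(Polynomial.monom 1 Q - Polynomial.monom 1 1) * G\<^sup>2 = smult c (H * (H\<^sup>2 + [:a:]))"
    and der: "pderiv H = smult \<kappa> (G\<^sup>2)"
    and nz: "c \<noteq> 0" "a \<noteq> 0" "\<kappa> \<noteq> 0" and G: "G \<noteq> 0" "2 * Polynomial.degree G + 1 < Q"
  shows False
proof -
  define m0 where "m0 = Polynomial.degree G"
  have step: "\<exists>m I. Polynomial.coeff G m \<noteq> 0 \<and> 2 * m + 1 + 2 * (Q - 1) * I = p ^ j * (2 * m0 + 1)" for j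
  proof (induction j)
    case 0
    show ?case by (rule exI[of _ m0], rule exI[of _ 0]) (simp add: m0_def G(1))
  next
    case (Suc j)
    then obtain m I where m: "Polynomial.coeff G m \<noteq> 0" "2 * m + 1 + 2 * (Q - 1) * I = p ^ j * (2 * m0 + 1)"
      by blast
    from coeff_mult_Artin_Schreier_power_neq_0[OF coeff_Cartier[OF p eq der nz m(1)]]
    obtain i m' where i: "i \<le> 2 * l" "p * m + (p - 1) = m' + Q * i + (2 * l - i)" "Polynomial.coeff G m' \<noteq> 0"
      by blast
    \<comment> \<open>Doubling the index equation and inserting \<open>4 * l = p - 1\<close> gives a
      recursion for the odd numbers \<open>2 * m + 1\<close>.\<close>
    have "Q * i = (Q - 1) * i + i" using G(2) by (cases Q) auto
    then have "p * (2 * m + 1) = 2 * m' + 1 + 2 * (Q - 1) * i"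
      using i(1,2) p(3) by simp
    then have "p ^ Suc j * (2 * m0 + 1) = 2 * m' + 1 + 2 * (Q - 1) * (i + p * I)"
      unfolding power_Suc mult.assoc m(2)[symmetric] by (simp add: algebra_simps)
    with i(3) show ?case by metis
  qed
  obtain m I where m: "Polynomial.coeff G m \<noteq> 0" "2 * m + 1 + 2 * (Q - 1) * I = Q * (2 * m0 + 1)"
    using step[of r] Q by blast
  have "m \<le> m0" using m(1) le_degree m0_def by blast
  define R where "R = Q - 1"
  have R: "Q = R + 1" "2 * m0 < R" using G(2) by (simp_all add: R_def m0_def)
  have "2 * m + 1 + 2 * R * I = (R + 1) * (2 * m0 + 1)" using m(2) R by simp
  then have "2 * m + R * (2 * I) = 2 * m0 + R * (2 * m0 + 1)" by (simp add: algebra_simps)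
  \<comment> \<open>The excess \<open>2 * (m0 - m)\<close> is smaller than \<open>R\<close>, so the
    even number \<open>2 * I\<close> would have to equal the odd number
    \<open>2 * m0 + 1\<close>.\<close>
  then have "2 * (m0 - m) + R * (2 * m0 + 1) = R * (2 * I)" using \<open>m \<le> m0\<close> by simp
  moreover have "2 * (m0 - m) < R" using R by simp
  ultimately have "R * (2 * m0 + 1) \<le> R * (2 * I)" "R * (2 * I) < R * (2 * m0 + 2)"
    by (linarith, simp add: algebra_simps)
  moreover have "R > 0" using R by simp
  ultimately have "2 * m0 + 1 \<le> 2 * I" "2 * I < 2 * m0 + 2" by (simp_all only: mult_le_cancel1 mult_less_cancel1)
  then show False by presburger
qed

section \<open>Degree comparison in the differential equation\<close>

text \<open>The constants 5 and 3 in the degree hypothesis are chosen against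
  \<open>Q + 2 * deg G = 3 * deg H\<close>: together they give \<open>3 * deg G < 2 * deg H\<close>,
  so every term other than \<open>C * H\<^sup>2 * W\<close> has degree below
  \<open>2 * deg H\<close>.\<close>

lemma depressed_cubic_solution:
  fixes H G \<tau> :: "'a::field poly"
  assumes eq: "\<tau> * G\<^sup>2 = smult c (H ^ 3 + smult a H + [:b:])"
    and \<tau>: "pderiv \<tau> = -1" "Polynomial.degree \<tau> = Q"
    and D: "5 * Polynomial.degree H < 3 * Q" and H: "pderiv H \<noteq> 0"
    and nz: "c \<noteq> 0" "(2::'a) \<noteq> 0" "(3::'a) \<noteq> 0"
  shows "b = 0 \<and> G\<^sup>2 = smult (2 * c * a) (pderiv H) \<and> G \<noteq> 0
    \<and> Q + 2 * Polynomial.degree G = 3 * Polynomial.degree H"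
proof -
  let ?D = "Polynomial.degree H" and ?g = "Polynomial.degree G"
  define A B C where "A = [:a:]" and "B = [:b:]" and "C = [:c:]"
  have C0: "C \<noteq> 0" using nz by (simp add: C_def)
  have D0: "?D > 0" using H pderiv_eq_0_iff by (metis degree_eq_zeroE gr0I pderiv_0 pderiv_pCons pCons_0_0 add_0)
  have H0: "H \<noteq> 0" using D0 by auto
  have n3: "(3::'a poly) \<noteq> 0" using nz by (simp add: numeral_poly)
  have eq': "\<tau> * G\<^sup>2 = C * (H ^ 3 + A * H + B)" using eq by (simp add: A_def B_def C_def)
  have dH: "Polynomial.degree (smult a H + [:b:]) < Polynomial.degree (H ^ 3)"
    using D0 H0 by (intro degree_add_less) (auto simp: degree_power_eq intro: le_less_trans[OF degree_smult_le])
  have degf: "Polynomial.degree (smult c (H ^ 3 + smult a H + [:b:])) = 3 * ?D"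
    using nz dH D0 H0 by (simp add: add.assoc degree_add_eq_left degree_power_eq)
  have G0: "G \<noteq> 0"
  proof
    assume "G = 0"
    then have "smult c (H ^ 3 + smult a H + [:b:]) = 0" using eq by simp
    then show False using degf D0 by (simp only: degree_0)
  qed
  have \<tau>0: "\<tau> \<noteq> 0" using \<tau>(1) by auto
  have deg: "Q + 2 * ?g = 3 * ?D"
    using arg_cong[OF eq, of Polynomial.degree] degf G0 \<tau>0 \<tau>(2) by (simp add: degree_mult_eq degree_power_eq)
  define G' H' where "G' = pderiv G" and "H' = pderiv H"
  have dG': "Polynomial.degree G' \<le> ?g" and dH': "Polynomial.degree H' \<le> ?D"
    unfolding G'_def H'_def using degree_pderiv_le by (metis diff_le_self le_trans)+
  \<comment> \<open>Up to a factor, \<open>W\<close> is the derivative of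
    \<open>G\<^sup>2 / H ^ 3\<close>.\<close>
  define W where "W = 2 * H * G' - 3 * H' * G"
  have "pderiv (\<tau> * G\<^sup>2) = 2 * \<tau> * G * G' - G\<^sup>2"
    by (simp add: power2_eq_square pderiv_mult \<tau> G'_def algebra_simps mult_2)
  moreover have "pderiv (C * (H ^ 3 + A * H + B)) = C * (3 * H\<^sup>2 * H' + A * H')"
  proof -
    have const: "pderiv A = 0" "pderiv B = 0" "pderiv C = 0" by (simp_all add: A_def B_def C_def pderiv_pCons)
    show ?thesis unfolding power3_eq_cube pderiv_mult pderiv_add const H'_def[symmetric] power2_eq_square by (simp add: algebra_simps power2_eq_square power3_eq_cube)
  qed
  ultimately have der: "2 * \<tau> * G * G' - G\<^sup>2 = C * (3 * H\<^sup>2 * H' + A * H')"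
    by (simp only: eq')
  \<comment> \<open>Combining the equation with its derivative eliminates \<open>\<tau>\<close>; the
    constant derivative of \<open>\<tau>\<close> leaves \<open>G ^ 3\<close>.\<close>
  have "G ^ 3 = 2 * G' * (\<tau> * G\<^sup>2) - G * (2 * \<tau> * G * G' - G\<^sup>2)" by (simp add: algebra_simps power2_eq_square power3_eq_cube)
  then have G3: "G ^ 3 = 2 * G' * (C * (H ^ 3 + A * H + B)) - G * (C * (3 * H\<^sup>2 * H' + A * H'))"
    unfolding eq' der .
  then have ode: "C * H\<^sup>2 * W = G ^ 3 - C * A * (2 * H * G' - H' * G) - 2 * C * B * G'"
    unfolding W_def by (simp add: algebra_simps power2_eq_square power3_eq_cube)
  have W0: "W = 0"
  proof (rule ccontr)
    assume "W \<noteq> 0"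
    then have "Polynomial.degree (C * H\<^sup>2 * W) = 2 * ?D + Polynomial.degree W"
      using C0 D0 H0 by (subst degree_mult_eq; auto simp: degree_mult_eq degree_power_eq C_def)
    moreover have "Polynomial.degree (G ^ 3 - C * A * (2 * H * G' - H' * G) - 2 * C * B * G') < 2 * ?D"
    proof (intro degree_diff_less)
      show "Polynomial.degree (G ^ 3) < 2 * ?D" using deg D G0 by (simp add: degree_power_eq)
      have g: "?g < ?D" using deg D D0 by linarith
      have "Polynomial.degree (2 * H * G') \<le> ?D + ?g"
        using dG' degree_mult_le[of "2 * H" G'] degree_mult_le[of 2 H] by (simp add: numeral_poly)
      moreover have "Polynomial.degree (H' * G) \<le> ?D + ?g"
        using dH' degree_mult_le[of H' G] by simp
      ultimately have "Polynomial.degree (2 * H * G' - H' * G) \<le> ?D + ?g" by (rule degree_diff_le)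
      then have "Polynomial.degree (smult (c * a) (2 * H * G' - H' * G)) < 2 * ?D"
        using g degree_smult_le[of "c * a" "2 * H * G' - H' * G"] by linarith
      moreover have "C * A * (2 * H * G' - H' * G) = smult (c * a) (2 * H * G' - H' * G)"
        by (simp add: C_def A_def mult.commute)
      ultimately show "Polynomial.degree (C * A * (2 * H * G' - H' * G)) < 2 * ?D"
        by (simp only:)
      have "2 * C * B * G' = smult (2 * c * b) G'" by (simp add: C_def B_def numeral_poly mult_ac)
      moreover have "Polynomial.degree (smult (2 * c * b) G') < 2 * ?D"
        using g dG' degree_smult_le[of "2 * c * b" G'] by linarith
      ultimately show "Polynomial.degree (2 * C * B * G') < 2 * ?D" by (simp only:)
    qed
    ultimately show False unfolding ode by simp
  qed
  then have W1: "2 * H * G' = 3 * H' * G" by (simp add: W_def)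
  have G'0: "G' \<noteq> 0"
  proof
    assume "G' = 0"
    then have "3 * H' * G = 0" using W1 by simp
    then show False using n3 G0 H by (simp add: H'_def)
  qed
  have ode': "G * (G\<^sup>2 - 2 * C * A * H') = 2 * C * B * G'"
    using ode unfolding W0 W1 by (simp add: algebra_simps power2_eq_square power3_eq_cube)
  \<comment> \<open>A non-zero left-hand side of \<open>ode'\<close> is a multiple of
    \<open>G\<close>, whereas the right-hand side has smaller degree than \<open>G\<close>.\<close>
  have b0: "b = 0"
  proof (rule ccontr)
    assume b: "b \<noteq> 0"
    have *: "2 * C * B * G' = smult (2 * c * b) G'" by (simp add: C_def B_def numeral_poly mult_ac)
    have "?g > 0" using G'0 unfolding G'_def
      by (metis degree_eq_zeroE gr0I pderiv_0 pderiv_pCons pCons_0_0 add_0)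
    then have "Polynomial.degree G' < ?g" unfolding G'_def using degree_pderiv_le[of G] by linarith
    then have "Polynomial.degree (G * (G\<^sup>2 - 2 * C * A * H')) < ?g"
      unfolding ode' * using degree_smult_le le_less_trans by blast
    moreover have "G * (G\<^sup>2 - 2 * C * A * H') \<noteq> 0" unfolding ode' * using b nz G'0 by simp
    ultimately show False by (simp add: degree_mult_eq)
  qed
  then have "G * (G\<^sup>2 - 2 * C * A * H') = 0" using ode' by (simp add: B_def)
  then have "G\<^sup>2 = 2 * C * A * H'" using G0 by simp
  also have "\<dots> = smult (2 * c * a) (pderiv H)" by (simp add: C_def A_def numeral_poly H'_def mult_ac)
  finally show ?thesis using b0 G0 deg by simp
qed

text \<open>Here \<open>H ^ 3\<close> has derivative zero, so the term \<open>G' * f\<close> stands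
  alone in the top degrees, which forces \<open>G' = 0\<close>. Then \<open>G\<^sup>2\<close> is an
  affine expression in \<open>H\<close> times \<open>H'\<close>, up to a constant. For
  \<open>a \<noteq> 0\<close> this has degree at least \<open>deg H\<close>, but
  \<open>2 * deg G = 3 * deg H - Q\<close> is less than \<open>deg H\<close>.\<close>

lemma cubic_solution_char_3:
  fixes H G \<tau> :: "'a::field poly"
  assumes eq: "\<tau> * G\<^sup>2 = smult c (H ^ 3 + smult a (H\<^sup>2) + smult b H + [:d:])"
    and \<tau>: "pderiv \<tau> = -1" "Polynomial.degree \<tau> = Q"
    and D: "2 * Polynomial.degree H < Q" and H: "pderiv H \<noteq> 0"
    and nz: "c \<noteq> 0" "(2::'a) \<noteq> 0" "(3::'a) = 0"
  shows "a = 0"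
proof -
  let ?D = "Polynomial.degree H" and ?g = "Polynomial.degree G"
  define A B C E where "A = [:a:]" and "B = [:b:]" and "C = [:c:]" and "E = [:d:]"
  have C0: "C \<noteq> 0" using nz by (simp add: C_def)
  have D0: "?D > 0" using H by (metis degree_eq_zeroE gr0I pderiv_0 pderiv_pCons pCons_0_0 add_0)
  have H0: "H \<noteq> 0" using D0 by auto
  have n2: "(2::'a poly) \<noteq> 0" and n3: "(3::'a poly) = 0" using nz by (simp_all add: numeral_poly)
  define f where "f = H ^ 3 + A * H\<^sup>2 + B * H + E"
  have eq': "\<tau> * G\<^sup>2 = C * f" using eq by (simp add: A_def B_def C_def E_def f_def)
  have dH: "Polynomial.degree (smult a (H\<^sup>2) + smult b H + [:d:]) < Polynomial.degree (H ^ 3)"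
    using D0 H0 by (intro degree_add_less) (auto simp: degree_power_eq intro: le_less_trans[OF degree_smult_le])
  have "f = H ^ 3 + (smult a (H\<^sup>2) + smult b H + [:d:])" by (simp add: f_def A_def B_def E_def add.assoc)
  then have degf: "Polynomial.degree f = 3 * ?D"
    using dH H0 by (simp add: degree_add_eq_left degree_power_eq)
  have f0: "f \<noteq> 0" using degf D0 by auto
  have G0: "G \<noteq> 0" using eq' f0 C0 by auto
  have \<tau>0: "\<tau> \<noteq> 0" using \<tau>(1) by auto
  have deg: "Q + 2 * ?g = 3 * ?D"
    using arg_cong[OF eq', of Polynomial.degree] degf G0 \<tau>0 \<tau>(2) C0 f0
    by (simp add: degree_mult_eq degree_power_eq C_def)
  have g: "?g < ?D" using deg D D0 by linarith
  define G' H' where "G' = pderiv G" and "H' = pderiv H"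
  have dG': "Polynomial.degree G' \<le> ?g" and dH': "Polynomial.degree H' \<le> ?D"
    unfolding G'_def H'_def using degree_pderiv_le by (metis diff_le_self le_trans)+
  have "pderiv (\<tau> * G\<^sup>2) = 2 * \<tau> * G * G' - G\<^sup>2"
    by (simp add: power2_eq_square pderiv_mult \<tau> G'_def algebra_simps mult_2)
  moreover have "pderiv (C * f) = C * (3 * H\<^sup>2 * H' + 2 * A * H * H' + B * H')"
  proof -
    have const: "pderiv A = 0" "pderiv B = 0" "pderiv C = 0" "pderiv E = 0"
      by (simp_all add: A_def B_def C_def E_def pderiv_pCons)
    show ?thesis
      unfolding f_def power3_eq_cube power2_eq_square pderiv_mult pderiv_add const H'_def[symmetric] by (simp add: algebra_simps power2_eq_square power3_eq_cube)
  qed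
  ultimately have der: "2 * \<tau> * G * G' - G\<^sup>2 = C * (3 * H\<^sup>2 * H' + 2 * A * H * H' + B * H')"
    by (simp only: eq')
  have "G ^ 3 = 2 * G' * (\<tau> * G\<^sup>2) - G * (2 * \<tau> * G * G' - G\<^sup>2)" by (simp add: algebra_simps power2_eq_square power3_eq_cube)
  then have "G ^ 3 = 2 * G' * (C * f) - G * (C * (3 * H\<^sup>2 * H' + 2 * A * H * H' + B * H'))"
    unfolding eq' der .
  then have ode: "2 * C * G' * f = G ^ 3 + C * (2 * A * H + B) * H' * G"
    unfolding n3 by (simp add: algebra_simps power2_eq_square power3_eq_cube)
  have aff: "C * (2 * A * H + B) = smult (2 * c * a) H + [:c * b:]"
    by (simp add: A_def B_def C_def numeral_poly algebra_simps)
  have G'0: "G' = 0"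
  proof (rule ccontr)
    assume "G' \<noteq> 0"
    then have "Polynomial.degree (2 * C * G' * f) \<ge> 3 * ?D"
      using C0 n2 f0 by (simp add: degree_mult_eq degf)
    moreover have "Polynomial.degree (G ^ 3 + C * (2 * A * H + B) * H' * G) < 3 * ?D"
    proof (intro degree_add_less)
      show "Polynomial.degree (G ^ 3) < 3 * ?D" using g G0 by (simp add: degree_power_eq)
      have "Polynomial.degree (C * (2 * A * H + B)) \<le> ?D"
        unfolding aff by (intro degree_add_le) (auto intro: degree_smult_le)
      then show "Polynomial.degree (C * (2 * A * H + B) * H' * G) < 3 * ?D"
        using dH' g degree_mult_le[of "C * (2 * A * H + B)" H']
          degree_mult_le[of "C * (2 * A * H + B) * H'" G] by linarith
    qed
    ultimately show False unfolding ode by simp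
  qed
  have "G * (G\<^sup>2 + C * (2 * A * H + B) * H') = 0"
    using ode unfolding G'0 by (simp add: algebra_simps power2_eq_square power3_eq_cube)
  then have G2: "G\<^sup>2 = - (C * (2 * A * H + B) * H')"
    using G0 by (simp add: add_eq_0_iff2)
  show "a = 0"
  proof (rule ccontr)
    assume a: "a \<noteq> 0"
    then have 1: "Polynomial.degree (C * (2 * A * H + B)) = ?D"
      unfolding aff using nz D0 by (simp add: degree_add_eq_left)
    then have "C * (2 * A * H + B) \<noteq> 0" using D0 by auto
    then have "Polynomial.degree (G\<^sup>2) \<ge> ?D"
      unfolding G2 using H 1 by (simp add: degree_mult_eq H'_def)
    then show False using deg D G0 by (simp add: degree_power_eq)
  qed
qed


section \<open>Finite base field: solutions and the twisted form of f\<close>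

lemma poly_map_const_fract: "poly (map_poly const_fract f) (to_fract F) = to_fract (pcompose f F)"
  for f F :: "'a::field poly"
  by (induction f) (simp_all add: map_poly_pCons const_fract_def pcompose_pCons)

lemma CHAR_eq_of_CARD_prime_power:
  assumes "Factorial_Ring.prime p" "CARD('a::{field,finite}) = p ^ r"
  shows "CHAR('a) = p"
proof -
  have "Factorial_Ring.prime CHAR('a)"
    using prime_CHAR_semidom finite_imp_CHAR_pos by (metis finite)
  moreover have "CHAR('a) dvd p ^ r" using CHAR_dvd_CARD[where 'a = 'a] assms(2) by simp
  ultimately show ?thesis using assms(1) prime_dvd_power primes_dvd_imp_eq by blast
qed

lemma power_CARD_eq_self:
  fixes x :: "'a::{field,finite}"
  shows "x ^ CARD('a) = x"
proof (cases "x = 0")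
  case True
  then show ?thesis by (simp add: finite_UNIV_card_ge_0)
next
  case False
  let ?U = "UNIV - {0::'a}"
  have "(\<Prod>y\<in>?U. y) = (\<Prod>y\<in>?U. x * y)"
    by (rule prod.reindex_bij_witness[of _ "\<lambda>y. x * y" "\<lambda>y. y / x"]) (use False in auto)
  also have "\<dots> = x ^ card ?U * (\<Prod>y\<in>?U. y)" by (simp add: prod.distrib)
  finally have "x ^ card ?U * (\<Prod>y\<in>?U. y) = 1 * (\<Prod>y\<in>?U. y)" by (simp only: mult_1)
  moreover have "(\<Prod>y\<in>?U. y) \<noteq> 0" by simp
  ultimately have "x ^ card ?U = 1" by (simp only: mult_cancel_right simp_thms)
  moreover have "CARD('a) = Suc (card ?U)" by (metis card.remove finite iso_tuple_UNIV_I)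
  ultimately show ?thesis by (simp only: power_Suc mult_1_right)
qed

text \<open>\<open>F\<close> maps all field elements to roots of \<open>f\<close>, no more than \<open>deg F\<close> of them to the same root.\<close>

lemma card_roots_ge_3:
  fixes f F G :: "'a::{field,finite} poly"
  assumes eq: "(Polynomial.monom 1 CARD('a) - Polynomial.monom 1 1) * G\<^sup>2 = pcompose f F"
    and F: "pderiv F \<noteq> 0" "2 * Polynomial.degree F < CARD('a)" and f: "f \<noteq> 0"
  shows "card {x. poly f x = 0} \<ge> 3"
proof -
  let ?R = "{x. poly f x = 0}"
  have "poly f (poly F u) = 0" for u
    using arg_cong[OF eq, of "\<lambda>P. poly P u"] by (simp add: poly_pcompose poly_monom power_CARD_eq_self)
  then have "UNIV = (\<Union>x\<in>?R. {u. poly F u = x})" by auto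
  then have "CARD('a) = card (\<Union>x\<in>?R. {u. poly F u = x})" by simp
  also have "\<dots> \<le> (\<Sum>x\<in>?R. card {u. poly F u = x})" by (rule card_UN_le) simp
  also have "\<dots> \<le> (\<Sum>x\<in>?R. Polynomial.degree F)"
  proof (rule sum_mono)
    fix x
    have "F - [:x:] \<noteq> 0"
    proof
      assume "F - [:x:] = 0"
      then have "F = [:x:]" by simp
      then show False using F(1) by (simp add: pderiv_pCons)
    qed
    then have "card {u. poly (F - [:x:]) u = 0} \<le> Polynomial.degree (F - [:x:])"
      by (rule card_poly_roots_bound)
    also have "\<dots> \<le> Polynomial.degree F" by (intro degree_diff_le) auto
    finally show "card {u. poly F u = x} \<le> Polynomial.degree F" by simp
  qed
  finally have "CARD('a) \<le> card ?R * Polynomial.degree F" by simp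
  with F(2) have "2 * Polynomial.degree F < card ?R * Polynomial.degree F" by linarith
  then have "2 < card ?R" by (simp only: mult_less_cancel2)
  then show ?thesis by linarith
qed

lemma card_ge_3_obtain:
  assumes "card A \<ge> 3"
  obtains x y z where "x \<in> A" "y \<in> A" "z \<in> A" "x \<noteq> y" "y \<noteq> z" "x \<noteq> z"
proof -
  obtain B where "B \<subseteq> A" "card B = 3" using assms by (meson obtain_subset_with_card_n)
  then show thesis using that by (auto simp: card_3_iff)
qed

lemma cubic_eq_pCons:
  fixes f :: "'a::zero poly"
  assumes "Polynomial.degree f = 3"
  shows "f = [:Polynomial.coeff f 0, Polynomial.coeff f 1, Polynomial.coeff f 2, Polynomial.coeff f 3:]"
  by (rule poly_eqI) (auto simp: coeff_pCons assms coeff_eq_0 eval_nat_numeral split: nat.split)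

lemma solution_imp_twist:
  fixes f F G :: "'a::{field,finite} poly"
  assumes p: "Factorial_Ring.prime p" "odd p" and Q: "CARD('a) = p ^ r" "r \<ge> 1"
    and f: "Polynomial.degree f = 3"
    and eq: "(Polynomial.monom 1 CARD('a) - Polynomial.monom 1 1) * G\<^sup>2 = pcompose f F"
    and F: "pderiv F \<noteq> 0" "2 * Polynomial.degree F < CARD('a)"
  shows "[p = 3] (mod 4) \<and> (\<exists>c e s. c \<noteq> 0 \<and> s \<noteq> 0 \<and> f = smult c ([:- e, 1:] ^ 3 - smult (s\<^sup>2) [:- e, 1:]))"
proof -
  define \<tau> where "\<tau> = Polynomial.monom 1 CARD('a) - Polynomial.monom (1::'a) 1"
  define c where "c = Polynomial.coeff f 3"
  have char: "CHAR('a) = p" by (rule CHAR_eq_of_CARD_prime_power[OF p(1) Q(1)])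
  have c0: "c \<noteq> 0" using f leading_coeff_0_iff[of f] by (auto simp: c_def)
  have f0: "f \<noteq> 0" using f by auto
  have nz: "of_nat m = (0::'a) \<longleftrightarrow> p dvd m" for m
    by (simp only: of_nat_eq_0_iff_char_dvd char)
  have p3: "p \<ge> 3" using p prime_ge_2_nat[of p] by (cases "p = 2") auto
  have two: "(2::'a) \<noteq> 0" using nz[of 2] p3 by (auto dest: dvd_imp_le)
  have Q1: "CARD('a) > 1" unfolding Q(1) using Q(2) p3 by (intro one_less_power) auto
  have \<tau>: "pderiv \<tau> = -1" "Polynomial.degree \<tau> = CARD('a)"
  proof -
    have "of_nat CARD('a) = (0::'a)" using Q by (subst nz) simp
    then show "pderiv \<tau> = -1" by (simp add: \<tau>_def pderiv_diff pderiv_monom one_pCons monom_0)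
    show "Polynomial.degree \<tau> = CARD('a)"
      using Q1 unfolding \<tau>_def diff_conv_add_uminus by (subst degree_add_eq_left) (simp_all add: degree_monom_eq)
  qed
  obtain x y z where xyz: "poly f x = 0" "poly f y = 0" "poly f z = 0" "x \<noteq> y" "y \<noteq> z" "x \<noteq> z"
    using card_ge_3_obtain[OF card_roots_ge_3[OF eq F f0]] by auto
  note cub = cubic_eq_pCons[OF f]
  show ?thesis
  proof (cases "p = 3")
    case True
    then have three: "(3::'a) = 0" using nz[of 3] by simp
    define a b d where "a = Polynomial.coeff f 2 / c" and "b = Polynomial.coeff f 1 / c" and "d = Polynomial.coeff f 0 / c"
    have f_eq: "f = smult c [:d, b, a, 1:]"
      by (subst cub) (use c0 in \<open>simp add: a_def b_def d_def c_def\<close>)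
    have "\<tau> * G\<^sup>2 = smult c (F ^ 3 + smult a (F\<^sup>2) + smult b F + [:d:])"
      unfolding eq[folded \<tau>_def] by (simp add: f_eq pcompose_pCons pcompose_smult power2_eq_square power3_eq_cube smult_add_right algebra_simps)
    from cubic_solution_char_3[OF this \<tau> F(2,1) c0 two three] have "a = 0" .
    \<comment> \<open>In characteristic 3 the map \<open>u ^ 3 + b * u\<close> is additive, so the
      difference of two roots is a zero of it; this gives \<open>b = - (s\<^sup>2)\<close>, and
      translation by the root \<open>x\<close> removes \<open>d\<close>.\<close>
    define s where "s = y - x"
    have s0: "s \<noteq> 0" using xyz by (simp add: s_def)
    have poly_f: "poly f u = c * (u ^ 3 + b * u + d)" for u
      by (simp add: f_eq \<open>a = 0\<close> power3_eq_cube algebra_simps)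
    have rx: "x ^ 3 + b * x + d = 0" and ry: "y ^ 3 + b * y + d = 0"
      using xyz(1,2) c0 by (simp_all add: poly_f)
    have cube: "(u - v) ^ 3 = u ^ 3 - v ^ 3" for u v :: 'a
    proof -
      have "(u - v) ^ 3 = u ^ 3 - v ^ 3 - 3 * (u * u * v - u * v * v)"
        by (simp add: power3_eq_cube algebra_simps)
      then show ?thesis by (simp add: three)
    qed
    have "s * (s\<^sup>2 + b) = (y - x) ^ 3 + b * (y - x)" by (simp add: s_def power3_eq_cube power2_eq_square algebra_simps)
    also have "\<dots> = (y ^ 3 + b * y + d) - (x ^ 3 + b * x + d)" unfolding cube by (simp add: algebra_simps)
    also have "\<dots> = 0" by (simp only: rx ry diff_self)
    finally have b: "b = - (s\<^sup>2)" using s0 by (simp add: add_eq_0_iff)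
    have d: "d = - (x ^ 3) + s\<^sup>2 * x" using rx by (simp add: b add_eq_0_iff algebra_simps)
    have "[:- x, 1:] ^ 3 = [:- (x ^ 3), 3 * x\<^sup>2, - 3 * x, 1:]"
      by (simp add: power3_eq_cube power2_eq_square)
    then have "f = smult c ([:- x, 1:] ^ 3 - smult (s\<^sup>2) [:- x, 1:])"
      unfolding f_eq \<open>a = 0\<close> by (simp add: three b d)
    moreover have "[p = 3] (mod 4)" by (simp add: True)
    ultimately show ?thesis using c0 s0 by blast
  next
    case False
    then have three: "(3::'a) \<noteq> 0"
      using nz[of 3] p(1) p3 primes_dvd_imp_eq[of p 3] by auto
    \<comment> \<open>The mean of the roots of \<open>f\<close>, which removes the quadratic
      term.\<close>
    define e where "e = - Polynomial.coeff f 2 / (3 * c)"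
    define a where "a = Polynomial.coeff f 1 / c - 3 * e\<^sup>2"
    define b where "b = Polynomial.coeff f 0 / c + e ^ 3 + a * e"
    have cube: "[:- e, 1:] ^ 3 = [:- (e ^ 3), 3 * e\<^sup>2, - 3 * e, 1:]"
      by (simp add: power3_eq_cube power2_eq_square)
    have f_eq: "f = smult c ([:- e, 1:] ^ 3 + smult a [:- e, 1:] + [:b:])"
      by (subst cub) (use c0 three in \<open>simp add: cube a_def b_def c_def[symmetric]; simp add: e_def field_simps\<close>)
    define H where "H = F - [:e:]"
    have H: "pderiv H = pderiv F" "Polynomial.degree H \<le> Polynomial.degree F"
      unfolding H_def by (simp add: pderiv_diff pderiv_pCons, intro degree_diff_le) auto
    have "pcompose [:- e, 1:] F = H" by (simp add: pcompose_pCons H_def)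
    then have "pcompose f F = smult c (H ^ 3 + smult a H + [:b:])"
      by (simp only: f_eq pcompose_smult pcompose_add power3_eq_cube pcompose_mult pcompose_const)
    then have eqH: "\<tau> * G\<^sup>2 = smult c (H ^ 3 + smult a H + [:b:])" using eq by (simp add: \<tau>_def)
    have "5 * Polynomial.degree H < 3 * CARD('a)" using H(2) F(2) by linarith
    from depressed_cubic_solution[OF eqH \<tau> this _ c0 two three] H F(1)
    have b: "b = 0" and G2: "G\<^sup>2 = smult (2 * c * a) (pderiv H)" and G0: "G \<noteq> 0"
      and deg: "CARD('a) + 2 * Polynomial.degree G = 3 * Polynomial.degree H" by auto
    \<comment> \<open>With \<open>b = 0\<close> the point \<open>e\<close> is a root; the distance
      \<open>s\<close> of any other root from it satisfies \<open>s\<^sup>2 = - a\<close>.\<close>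
    obtain x' where x': "poly f x' = 0" "x' \<noteq> e" using xyz by metis
    define s where "s = x' - e"
    have s0: "s \<noteq> 0" using x' by (simp add: s_def)
    have "c * (s * (s\<^sup>2 + a)) = poly f x'"
      by (simp add: f_eq b s_def power3_eq_cube power2_eq_square algebra_simps)
    then have a: "a = - (s\<^sup>2)" using x' c0 s0 by (simp add: add_eq_0_iff)
    have f_tw: "f = smult c ([:- e, 1:] ^ 3 - smult (s\<^sup>2) [:- e, 1:])"
      by (subst f_eq) (simp only: a b smult_minus_left diff_conv_add_uminus pCons_0_0 add_0_right)
    have "p mod 4 = 3"
    proof (rule ccontr)
      assume "p mod 4 \<noteq> 3"
      then have "p mod 4 = 1" using p(2) by presburger
      then obtain l where l: "p = 4 * l + 1" by (metis mult_div_mod_eq)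
      define \<kappa> where "\<kappa> = inverse (2 * c * a)"
      have ka: "2 * c * a \<noteq> 0" using a s0 c0 two by simp
      then have "\<kappa> * (2 * c * a) = 1" unfolding \<kappa>_def by (rule left_inverse)
      then have der: "pderiv H = smult \<kappa> (G\<^sup>2)" "\<kappa> \<noteq> 0"
        by (simp only: G2 smult_smult smult_1_left) (use ka in \<open>simp add: \<kappa>_def\<close>)
      have "(Polynomial.monom 1 (p ^ r) - Polynomial.monom 1 1) * G\<^sup>2 = smult c (H * (H\<^sup>2 + [:a:]))"
        using eqH by (simp add: \<tau>_def Q b power2_eq_square power3_eq_cube algebra_simps)
      \<comment> \<open>The degree condition holds because \<open>2 * deg G = 3 * deg H - Q\<close>
        is below \<open>Q / 2\<close>.\<close>
      from Artin_Schreier_no_solution_1_mod_4[OF char p(1) l refl this der(1) c0 _ der(2) G0]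
      show False using ka deg H(2) F(2) Q(1) by auto
    qed
    then have "[p = 3] (mod 4)" by (simp add: cong_def)
    then show ?thesis using c0 s0 f_tw by blast
  qed
qed

text \<open>
  \<open>T\<close> is the trace polynomial in \<open>\<mu> t\<close>, so that \<open>T\<^sup>p - T = \<mu> \<tau>\<close>, and \<open>v = T\<^sup>2\<^sup>w\<^sup>+\<^sup>1\<close> with
  \<open>p = 4 w + 3\<close> satisfies \<open>v\<^sup>3 - v = (T\<^sup>w)\<^sup>2 (T\<^sup>p - T)\<close>.
\<close>

lemma twist_imp_solution:
  fixes f :: "'a::{field,finite} poly"
  assumes p: "Factorial_Ring.prime p" "p mod 4 = 3" "CHAR('a) = p" and Q: "CARD('a) = p ^ r" "r \<ge> 1"
    and f: "f = smult c ([:\<beta>, \<alpha>:] ^ 3 - [:\<beta>, \<alpha>:])" "c \<noteq> 0" "\<alpha> \<noteq> 0"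
  shows "\<exists>F G. (Polynomial.monom 1 CARD('a) - Polynomial.monom 1 1) * G\<^sup>2 = pcompose f F
    \<and> pderiv F \<noteq> 0 \<and> 2 * Polynomial.degree F \<le> CARD('a) - 1"
proof -
  define \<tau> where "\<tau> = Polynomial.monom 1 CARD('a) - Polynomial.monom (1::'a) 1"
  \<comment> \<open>Chosen so that \<open>c\<close> times \<open>T ^ p - T\<close> is
    \<open>\<tau>\<close>.\<close>
  define \<mu> where "\<mu> = 1 / c"
  define T where "T = (\<Sum>i<r. Polynomial.monom (\<mu> ^ (p ^ i)) (p ^ i))"
  define w where "w = p div 4"
  have pw: "p = 4 * w + 3" using p(2) by (metis mult_div_mod_eq w_def)
  have \<mu>0: "\<mu> \<noteq> 0" using f by (simp add: \<mu>_def)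
  have nz: "of_nat m = (0::'a) \<longleftrightarrow> p dvd m" for m
    by (simp only: of_nat_eq_0_iff_char_dvd p(3))
  have "T ^ p = (\<Sum>i<r. Polynomial.monom (\<mu> ^ (p ^ i)) (p ^ i) ^ p)"
    unfolding T_def by (rule freshmans_dream_sum) (simp_all add: p)
  also have "\<dots> = (\<Sum>i<r. Polynomial.monom (\<mu> ^ (p ^ Suc i)) (p ^ Suc i))"
    by (intro sum.cong refl) (simp add: monom_power power_mult[symmetric] mult.commute)
  finally have "T ^ p - T = (\<Sum>i<r. Polynomial.monom (\<mu> ^ (p ^ Suc i)) (p ^ Suc i) - Polynomial.monom (\<mu> ^ (p ^ i)) (p ^ i))"
    by (simp only: T_def sum_subtractf)
  also have "\<dots> = Polynomial.monom (\<mu> ^ (p ^ r)) (p ^ r) - Polynomial.monom (\<mu> ^ (p ^ 0)) (p ^ 0)"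
    by (rule sum_lessThan_telescope)
  \<comment> \<open>Here \<open>\<mu> ^ CARD('a) = \<mu>\<close> gives the two surviving monomials
    the same coefficient up to sign.\<close>
  also have "\<dots> = smult \<mu> \<tau>"
    using power_CARD_eq_self[of \<mu>] by (simp add: \<tau>_def Q(1) smult_diff_right smult_monom)
  finally have T: "T ^ p - T = smult \<mu> \<tau>" .
  have dT: "pderiv T = [:\<mu>:]"
  proof -
    have "pderiv T = (\<Sum>i<r. pderiv (Polynomial.monom (\<mu> ^ (p ^ i)) (p ^ i)))"
      using higher_pderiv_sum[of 1] by (simp add: T_def)
    also have "\<dots> = (\<Sum>i<r. if i = 0 then [:\<mu>:] else 0)"
    proof (intro sum.cong refl)
      fix i
      have "of_nat (p ^ i) = (0::'a)" if "i \<noteq> 0" using that by (subst nz) auto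
      then show "pderiv (Polynomial.monom (\<mu> ^ (p ^ i)) (p ^ i)) = (if i = 0 then [:\<mu>:] else 0)"
        by (auto simp: pderiv_monom monom_0 simp del: of_nat_power)
    qed
    also have "\<dots> = [:\<mu>:]" using Q(2) by (simp add: sum.delta)
    finally show ?thesis .
  qed
  then have T0: "T \<noteq> 0" using \<mu>0 by auto
  have degT: "Polynomial.degree T \<le> p ^ (r - 1)"
    unfolding T_def
  proof (intro degree_sum_le)
    fix i assume "i \<in> {..<r}"
    then have "p ^ i \<le> p ^ (r - 1)" using pw by (intro power_increasing) auto
    then show "Polynomial.degree (Polynomial.monom (\<mu> ^ (p ^ i)) (p ^ i)) \<le> p ^ (r - 1)"
      by (rule le_trans[OF degree_monom_le])
  qed simp
  define F where "F = smult (1 / \<alpha>) (T ^ (2 * w + 1) - [:\<beta>:])"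
  have aff: "pcompose [:\<beta>, \<alpha>:] F = T ^ (2 * w + 1)"
    using f(3) by (simp add: pcompose_pCons F_def)
  have "pcompose f F = smult c ((T ^ (2 * w + 1)) ^ 3 - T ^ (2 * w + 1))"
    unfolding f(1) by (simp only: pcompose_smult pcompose_diff power3_eq_cube pcompose_mult aff)
  \<comment> \<open>Since \<open>p = 4 * w + 3\<close>, the exponent \<open>3 * (2 * w + 1)\<close>
    is \<open>2 * w + p\<close>.\<close>
  also have "(T ^ (2 * w + 1)) ^ 3 - T ^ (2 * w + 1) = (T ^ w)\<^sup>2 * (T ^ p - T)"
    by (simp add: pw algebra_simps flip: power_mult power_add power_Suc)
  also have "smult c \<dots> = \<tau> * (T ^ w)\<^sup>2"
    using f(2) by (simp add: T \<mu>_def mult.commute)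
  finally have eq: "\<tau> * (T ^ w)\<^sup>2 = pcompose f F" ..
  have "\<not> p dvd 2 * w + 1" using pw by (auto dest!: dvd_imp_le)
  then have "of_nat (2 * w + 1) \<noteq> (0::'a)" by (simp only: nz not_False_eq_True)
  then have dF: "pderiv F \<noteq> 0"
    using T0 \<mu>0 f(3) by (simp add: F_def pderiv_smult pderiv_diff pderiv_pCons pderiv_power_Suc dT del: power_Suc of_nat_Suc)
  have "Polynomial.degree (T ^ (2 * w + 1) - [:\<beta>:]) \<le> p ^ (r - 1) * (2 * w + 1)"
  proof (rule degree_diff_le)
    have "Polynomial.degree (T ^ (2 * w + 1)) \<le> Polynomial.degree T * (2 * w + 1)" by (rule degree_power_le)
    also have "\<dots> \<le> p ^ (r - 1) * (2 * w + 1)" using degT by (rule mult_right_mono) simp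
    finally show "Polynomial.degree (T ^ (2 * w + 1)) \<le> p ^ (r - 1) * (2 * w + 1)" .
  qed simp
  then have "Polynomial.degree F \<le> p ^ (r - 1) * (2 * w + 1)"
    using degree_smult_le le_trans unfolding F_def by blast
  then have "2 * Polynomial.degree F \<le> p ^ (r - 1) * (p - 1)" using pw by simp
  also have "\<dots> = p ^ r - p ^ (r - 1)"
    using Q(2) by (cases r) (simp_all add: right_diff_distrib' mult.commute)
  also have "\<dots> \<le> CARD('a) - 1" unfolding Q(1) using pw by (intro diff_le_mono2) simp
  finally show ?thesis using eq dF unfolding \<tau>_def by blast
qed

section \<open>Isomorphisms of plane cubics\<close>

lemma hcoord_eq: "hcoord (x, y, z) = {(c * x, c * y, c * z) | c. c \<noteq> 0}"
  by (simp add: hcoord_def)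

lemma hcoord_eq_iff:
  "hcoord (x, y, z) = hcoord (x', y', z') \<longleftrightarrow> (\<exists>c. c \<noteq> 0 \<and> x' = c * x \<and> y' = c * y \<and> z' = c * z)"
  (is "?L \<longleftrightarrow> ?R")
proof
  assume ?L
  moreover have "(x', y', z') \<in> hcoord (x', y', z')" unfolding hcoord_eq by (auto intro!: exI[of _ 1])
  ultimately have "(x', y', z') \<in> hcoord (x, y, z)" by simp
  then show ?R unfolding hcoord_eq by blast
next
  assume ?R
  then obtain c where c: "c \<noteq> 0" "x' = c * x" "y' = c * y" "z' = c * z" by blast
  show ?L
  proof (intro equalityI subsetI)
    fix v assume "v \<in> hcoord (x, y, z)"
    then obtain d where "d \<noteq> 0" "v = (d * x, d * y, d * z)" unfolding hcoord_eq by blast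
    with c have "d / c \<noteq> 0 \<and> v = ((d / c) * x', (d / c) * y', (d / c) * z')" by simp
    then show "v \<in> hcoord (x', y', z')" unfolding hcoord_eq by blast
  next
    fix v assume "v \<in> hcoord (x', y', z')"
    then obtain d where "d \<noteq> 0" "v = (d * x', d * y', d * z')" unfolding hcoord_eq by blast
    with c have "d * c \<noteq> 0 \<and> v = ((d * c) * x, (d * c) * y, (d * c) * z)" by (simp add: mult_ac)
    then show "v \<in> hcoord (x, y, z)" unfolding hcoord_eq by blast
  qed
qed

text \<open>Membership in \<open>proj_points\<close> asks for one representative satisfying the
  equation; homogeneity of degree 3 carries the equation to all others.\<close>

lemma hcoord_mem_proj_points:
  "hcoord (x, y, z) \<in> proj_points d f \<longleftrightarrow> (x, y, z) \<noteq> (0, 0, 0) \<and>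
     d * y ^ 2 * z = (\<Sum>i\<le>3. Polynomial.coeff f i * x ^ i * z ^ (3 - i))" (is "?L \<longleftrightarrow> ?R")
proof
  assume ?R then show ?L unfolding proj_points_def by blast
next
  assume ?L
  then obtain x' y' z' where h: "hcoord (x', y', z') = hcoord (x, y, z)" "(x', y', z') \<noteq> (0, 0, 0)"
    "d * y' ^ 2 * z' = (\<Sum>i\<le>3. Polynomial.coeff f i * x' ^ i * z' ^ (3 - i))"
    unfolding proj_points_def by auto
  obtain c where c: "c \<noteq> 0" "x = c * x'" "y = c * y'" "z = c * z'"
    using h(1) unfolding hcoord_eq_iff by blast
  have "d * y ^ 2 * z = c ^ 3 * (d * y' ^ 2 * z')"
    by (simp add: c power2_eq_square power3_eq_cube mult_ac)
  also have "\<dots> = (\<Sum>i\<le>3. Polynomial.coeff f i * x ^ i * z ^ (3 - i))"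
    unfolding h(3) by (simp add: c eval_nat_numeral algebra_simps)
  finally show ?R using c h(2) by auto
qed

section \<open>Affine substitutions as isomorphisms\<close>

text \<open>A linear map on coordinate vectors, whose image map acts on points. It leaves
  \<open>y\<close> alone because a rescaling of \<open>y\<close> can be absorbed in the twisting
  factor.\<close>

definition affine_map :: "'a::field \<Rightarrow> 'a \<Rightarrow> 'a alg_closure \<times> 'a alg_closure \<times> 'a alg_closure
    \<Rightarrow> 'a alg_closure \<times> 'a alg_closure \<times> 'a alg_closure" where
  "affine_map \<alpha> \<beta> = (\<lambda>(x, y, z). (to_ac \<alpha> * x + to_ac \<beta> * z, y, z))"

lemma affine_map_hcoord: "affine_map \<alpha> \<beta> ` hcoord v = hcoord (affine_map \<alpha> \<beta> v)"
  by (cases v) (force simp: affine_map_def hcoord_eq image_iff algebra_simps)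

lemma affine_map_inverse:
  assumes "\<alpha> * \<alpha>' = 1" "\<beta>' = - \<alpha>' * \<beta>"
  shows "affine_map \<alpha>' \<beta>' (affine_map \<alpha> \<beta> v) = v"
proof -
  have "to_ac \<alpha>' * to_ac \<alpha> = 1" using assms(1) by (metis mult.commute to_ac_1 to_ac_mult)
  then show ?thesis
    by (cases v) (simp add: affine_map_def assms(2) distrib_left flip: mult.assoc)
qed

text \<open>For \<open>\<alpha> \<noteq> 0\<close> the three linear forms have no common zero, so
  one triple serves at every point.\<close>

lemma morphism_over_affine_map:
  assumes "\<alpha> \<noteq> 0"
    and "\<And>v. hcoord v \<in> proj_points d f \<Longrightarrow> hcoord (affine_map \<alpha> \<beta> v) \<in> proj_points e g"
  shows "morphism_over (proj_points d f) (proj_points e g) ((`) (affine_map \<alpha> \<beta>))"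
  unfolding morphism_over_def
proof (intro conjI ballI)
  show "(`) (affine_map \<alpha> \<beta>) ` proj_points d f \<subseteq> proj_points e g"
  proof
    fix P assume "P \<in> (`) (affine_map \<alpha> \<beta>) ` proj_points d f"
    then obtain R where "R \<in> proj_points d f" "P = affine_map \<alpha> \<beta> ` R" by blast
    moreover from this obtain v where "R = hcoord v" unfolding proj_points_def by blast
    ultimately show "P \<in> proj_points e g" using assms(2) by (simp add: affine_map_hcoord)
  qed
next
  fix P assume P: "P \<in> proj_points d f"
  then obtain x y z where v: "P = hcoord (x, y, z)" "(x, y, z) \<noteq> (0, 0, 0)"
    unfolding proj_points_def by blast
  \<comment> \<open>In degree 1 the index pairs (1, 0), (0, 1) and (0, 0) stand for X, Y and
    Z.\<close>
  define A\<^sub>0 A\<^sub>1 A\<^sub>2 where "A\<^sub>0 = (\<lambda>(i::nat) (j::nat). if i = 1 \<and> j = 0 then \<alpha> else if i = 0 \<and> j = 0 then \<beta> else 0)"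
    and "A\<^sub>1 = (\<lambda>(i::nat) (j::nat). if i = 0 \<and> j = 1 then 1 else 0::'a)"
    and "A\<^sub>2 = (\<lambda>(i::nat) (j::nat). if i = 0 \<and> j = 0 then 1 else 0::'a)"
  have ev: "(form_eval 1 A\<^sub>0 v, form_eval 1 A\<^sub>1 v, form_eval 1 A\<^sub>2 v) = affine_map \<alpha> \<beta> v" for v
    by (cases v) (simp add: form_eval_def affine_map_def A\<^sub>0_def A\<^sub>1_def A\<^sub>2_def add.commute)
  have "affine_map \<alpha> \<beta> (x, y, z) \<noteq> (0, 0, 0)"
    using v(2) assms(1) by (auto simp: affine_map_def)
  with v(1) have 1: "\<exists>v. P = hcoord v \<and> affine_map \<alpha> \<beta> v \<noteq> (0, 0, 0)" by blast
  show "\<exists>m A\<^sub>0 A\<^sub>1 A\<^sub>2. let ev = (\<lambda>v. (form_eval m A\<^sub>0 v, form_eval m A\<^sub>1 v, form_eval m A\<^sub>2 v)) in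
        (\<exists>v. P = hcoord v \<and> ev v \<noteq> (0, 0, 0)) \<and>
        (\<forall>v. hcoord v \<in> proj_points d f \<and> ev v \<noteq> (0, 0, 0) \<longrightarrow> (`) (affine_map \<alpha> \<beta>) (hcoord v) = hcoord (ev v))"
    by (rule exI[of _ 1], rule exI[of _ A\<^sub>0], rule exI[of _ A\<^sub>1], rule exI[of _ A\<^sub>2])
      (use 1 in \<open>unfold Let_def ev affine_map_hcoord, blast\<close>)
qed

lemma twist_imp_isomorphic:
  fixes f :: "'a::field poly"
  assumes f: "f = smult c ([:- e, 1:] ^ 3 - smult (s\<^sup>2) [:- e, 1:])" and nz: "c \<noteq> 0" "s \<noteq> 0"
  shows "\<exists>a. a \<noteq> 0 \<and> isomorphic_over 1 f a (Polynomial.monom 1 3 - Polynomial.monom 1 1)"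
proof (intro exI conjI)
  let ?g = "Polynomial.monom 1 3 - Polynomial.monom 1 1 :: 'a poly"
  \<comment> \<open>Substituting \<open>x = s * u + e\<close> turns \<open>f\<close> into
    \<open>c * s ^ 3 * (u ^ 3 - u)\<close>.\<close>
  define a where "a = 1 / (c * s ^ 3)"
  show "a \<noteq> 0" using nz by (simp add: a_def)
  define c' e' s' where "c' = to_ac c" and "e' = to_ac e" and "s' = to_ac s"
  have nz': "c' \<noteq> 0" "s' \<noteq> 0" using nz by (simp_all add: c'_def s'_def)
  have a': "to_ac a = 1 / (c' * s' ^ 3)" by (simp add: a_def c'_def s'_def)
  let ?C = "proj_points (to_ac 1) (map_poly to_ac f)"
  let ?D = "proj_points (to_ac a) (map_poly to_ac ?g)"
  let ?\<phi> = "affine_map (1 / s) (- e / s)" and ?\<psi> = "affine_map s e"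
  have "f = [:c * (- (e ^ 3) + s\<^sup>2 * e), c * (3 * e\<^sup>2 - s\<^sup>2), - (3 * c * e), c:]"
    by (simp add: f power3_eq_cube power2_eq_square algebra_simps)
  then have C: "hcoord (x, y, z) \<in> ?C \<longleftrightarrow> (x, y, z) \<noteq> (0, 0, 0) \<and>
      y\<^sup>2 * z = c' * ((x - e' * z) ^ 3 - s'\<^sup>2 * (x - e' * z) * z\<^sup>2)" for x y z
    by (simp add: hcoord_mem_proj_points coeff_map_poly numeral_3_eq_3 numeral_2_eq_2 coeff_pCons
        c'_def e'_def s'_def algebra_simps)
  have D: "hcoord (x, y, z) \<in> ?D \<longleftrightarrow> (x, y, z) \<noteq> (0, 0, 0) \<and>
      to_ac a * y\<^sup>2 * z = x ^ 3 - x * z\<^sup>2" for x y z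
    by (simp add: hcoord_mem_proj_points coeff_map_poly numeral_3_eq_3 numeral_2_eq_2)
  have CD: "hcoord (?\<phi> v) \<in> ?D" if "hcoord v \<in> ?C" for v
  proof (cases v)
    case (fields x y z)
    define u where "u = (x - e' * z) / s'"
    have u_eq: "x - e' * z = s' * u" using nz' by (simp add: u_def)
    have v: "?\<phi> v = (u, y, z)" by (simp add: fields affine_map_def u_def diff_divide_distrib e'_def s'_def)
    have "(u, y, z) \<noteq> (0, 0, 0)" using that u_eq unfolding fields C by auto
    moreover have "y\<^sup>2 * z = c' * s' ^ 3 * (u ^ 3 - u * z\<^sup>2)"
      using that unfolding fields C u_eq by (simp add: power3_eq_cube power2_eq_square algebra_simps)
    ultimately show ?thesis unfolding v D unfolding a' using nz' by simp
  qed
  have DC: "hcoord (?\<psi> v) \<in> ?C" if "hcoord v \<in> ?D" for v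
  proof (cases v)
    case (fields u y z)
    have v: "?\<psi> v = (s' * u + e' * z, y, z)" by (simp add: fields affine_map_def e'_def s'_def)
    have "to_ac a * y\<^sup>2 * z = u ^ 3 - u * z\<^sup>2" "(u, y, z) \<noteq> (0, 0, 0)" using that unfolding fields D by auto
    moreover from this(1) have "y\<^sup>2 * z = c' * s' ^ 3 * (u ^ 3 - u * z\<^sup>2)" using nz' by (simp add: a' field_simps)
    ultimately show ?thesis
      unfolding v C using nz' by (auto simp: power3_eq_cube power2_eq_square algebra_simps)
  qed
  have inv: "?\<psi> (?\<phi> v) = v" "?\<phi> (?\<psi> v) = v" for v
    using nz by (auto intro!: affine_map_inverse)
  have "?\<phi> ` origin = origin" by (simp add: origin_def affine_map_hcoord) (simp add: affine_map_def)
  moreover have "morphism_over ?C ?D ((`) ?\<phi>)" "morphism_over ?D ?C ((`) ?\<psi>)"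
    by (rule morphism_over_affine_map[OF _ CD], use nz in simp, assumption)
      (rule morphism_over_affine_map[OF _ DC], use nz in simp, assumption)
  moreover have "\<forall>P\<in>?C. ?\<psi> ` ?\<phi> ` P = P" "\<forall>P\<in>?D. ?\<phi> ` ?\<psi> ` P = P"
    by (auto simp only: image_image inv image_ident)
  ultimately show "isomorphic_over 1 f a ?g"
    unfolding isomorphic_over_def Let_def by blast
qed

section \<open>Regular functions on the affine curve\<close>

text \<open>The equation of the curve reduces every polynomial in \<open>x\<close> and
  \<open>y\<close> to the form \<open>a + b y\<close>. The values of \<open>u\<close> off the curve
  are immaterial.\<close>

definition regular :: "'k::field \<Rightarrow> 'k poly \<Rightarrow> ('k \<times> 'k \<Rightarrow> 'k) \<Rightarrow> bool" where
  "regular d f u \<longleftrightarrow> (\<exists>a b. \<forall>(x, y)\<in>affine_points d f. u (x, y) = poly a x + poly b x * y)"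

lemma regularI:
  "(\<And>x y. d * y\<^sup>2 = poly f x \<Longrightarrow> u (x, y) = poly a x + poly b x * y) \<Longrightarrow> regular d f u"
  unfolding regular_def affine_points_def by blast

lemma regularE:
  assumes "regular d f u"
  obtains a b where "\<And>x y. d * y\<^sup>2 = poly f x \<Longrightarrow> u (x, y) = poly a x + poly b x * y"
  using assms unfolding regular_def affine_points_def by blast

lemma regular_cong:
  assumes "regular d f v" "\<And>P. P \<in> affine_points d f \<Longrightarrow> u P = v P"
  shows "regular d f u"
proof -
  obtain a b where "\<And>x y. d * y\<^sup>2 = poly f x \<Longrightarrow> v (x, y) = poly a x + poly b x * y"
    using assms(1) by (auto elim: regularE)
  then show ?thesis using assms(2) by (intro regularI[of _ _ _ a b]) (simp add: affine_points_def)
qed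

lemma regular_const: "regular d f (\<lambda>_. c)"
  by (rule regularI[of _ _ _ "[:c:]" 0]) simp

lemma regular_fst: "regular d f fst"
  by (rule regularI[of _ _ _ "[:0, 1:]" 0]) simp

lemma regular_snd: "regular d f snd"
  by (rule regularI[of _ _ _ 0 1]) simp

lemma regular_poly: "regular d f (\<lambda>P. poly w (fst P))"
  by (rule regularI[of _ _ _ w 0]) simp

lemma regular_add:
  assumes "regular d f u" "regular d f w"
  shows "regular d f (\<lambda>P. u P + w P)"
proof -
  obtain a b a' b' where
    "\<And>x y. d * y\<^sup>2 = poly f x \<Longrightarrow> u (x, y) = poly a x + poly b x * y"
    "\<And>x y. d * y\<^sup>2 = poly f x \<Longrightarrow> w (x, y) = poly a' x + poly b' x * y"
    using assms by (auto elim!: regularE)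
  then show ?thesis
    by (intro regularI[of _ _ _ "a + a'" "b + b'"]) (simp add: algebra_simps)
qed

lemma regular_mult:
  assumes "regular d f u" "regular d f w" "d \<noteq> 0"
  shows "regular d f (\<lambda>P. u P * w P)"
proof -
  obtain a b a' b' where
    uw: "\<And>x y. d * y\<^sup>2 = poly f x \<Longrightarrow> u (x, y) = poly a x + poly b x * y"
    "\<And>x y. d * y\<^sup>2 = poly f x \<Longrightarrow> w (x, y) = poly a' x + poly b' x * y"
    using assms by (auto elim!: regularE)
  show ?thesis
  proof (rule regularI[of _ _ _ "a * a' + smult (1 / d) (b * b' * f)" "a * b' + a' * b"])
    fix x y assume xy: "d * y\<^sup>2 = poly f x"
    have "poly (smult (1 / d) (b * b' * f)) x = poly b x * poly b' x * y\<^sup>2"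
      using assms(3) by (simp flip: xy)
    then show "u (x, y) * w (x, y) = poly (a * a' + smult (1 / d) (b * b' * f)) x + poly (a * b' + a' * b) x * y"
      by (simp add: uw[OF xy] algebra_simps power2_eq_square)
  qed
qed

lemma regular_power:
  assumes "regular d f u" "d \<noteq> 0"
  shows "regular d f (\<lambda>P. u P ^ n)"
  by (induction n) (simp_all add: regular_const regular_mult assms)

lemma regular_sum:
  assumes "\<And>i. i \<in> I \<Longrightarrow> regular d f (u i)"
  shows "regular d f (\<lambda>P. \<Sum>i\<in>I. u i P)"
  using assms by (induction I rule: infinite_finite_induct) (simp_all add: regular_const regular_add)

lemma regular_form_eval:
  assumes "d \<noteq> 0"
  shows "regular d f (\<lambda>P. form_eval m A (fst P, snd P, 1))"
  unfolding form_eval_def prod.case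
  by (intro regular_sum regular_mult regular_power regular_const regular_fst regular_snd assms)

lemma exists_snd:
  fixes f :: "'k::alg_closed_field poly"
  assumes "d \<noteq> 0"
  obtains y where "d * y\<^sup>2 = poly f x"
proof -
  have "Polynomial.degree [:- (poly f x / d), 0, 1:] = 2" by simp
  then obtain y where "poly [:- (poly f x / d), 0, 1:] y = 0"
    using alg_closed_imp_poly_has_root[of "[:- (poly f x / d), 0, 1:]"] by auto
  then have "y\<^sup>2 = poly f x / d" by (simp add: power2_eq_square)
  then have "d * y\<^sup>2 = poly f x" using assms by simp
  then show thesis by (rule that)
qed

text \<open>
  Nullstellensatz for the affine curve.  The denominators of \<open>u\<close> in \<open>k[x]\<close> form an ideal; taking
  norms of denominators that are non-zero at both points above \<open>x\<^sub>0\<close> shows that no \<open>x\<^sub>0\<close> is a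
  zero of this ideal.
\<close>

lemma locally_regular_imp_regular:
  fixes f :: "'k::alg_closed_field poly"
  assumes d: "d \<noteq> 0"
    and loc: "\<And>P. P \<in> affine_points d f \<Longrightarrow>
      \<exists>g h. regular d f g \<and> regular d f h \<and> h P \<noteq> 0 \<and> (\<forall>R\<in>affine_points d f. g R = u R * h R)"
  shows "regular d f u"
proof -
  define W where "W = {w. regular d f (\<lambda>P. poly w (fst P) * u P)}"
  have W_nz: "\<exists>w\<in>W. poly w x \<noteq> 0" for x
  proof -
    obtain y where y: "d * y\<^sup>2 = poly f x" by (rule exists_snd[OF d])
    define I where "I = {h. regular d f h \<and> regular d f (\<lambda>P. u P * h P)}"
    have I: "\<exists>h\<in>I. h P \<noteq> 0" if P: "P \<in> affine_points d f" for P
    proof -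
      obtain g h where gh: "regular d f g" "regular d f h" "h P \<noteq> 0"
        "\<forall>R\<in>affine_points d f. g R = u R * h R" using loc[OF P] by blast
      then have "regular d f (\<lambda>P. u P * h P)" by (intro regular_cong[OF gh(1)]) simp
      with gh show ?thesis by (auto simp: I_def)
    qed
    have "(x, y) \<in> affine_points d f" "(x, - y) \<in> affine_points d f" using y by (simp_all add: affine_points_def)
    then obtain h1 h2 where h12: "h1 \<in> I" "h1 (x, y) \<noteq> 0" "h2 \<in> I" "h2 (x, - y) \<noteq> 0" using I by meson
    have "(\<lambda>P. h1 P + h2 P) \<in> I" using h12 by (simp add: I_def distrib_left regular_add)
    \<comment> \<open>One of \<open>h1\<close>, \<open>h2\<close> and their sum is non-zero at both
      points.\<close>
    then obtain h where h: "h \<in> I" "h (x, y) \<noteq> 0" "h (x, - y) \<noteq> 0"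
      using h12 by (cases "h1 (x, - y) = 0"; cases "h2 (x, y) = 0") force+
    have hI: "regular d f h" "regular d f (\<lambda>P. u P * h P)" using h(1) by (simp_all add: I_def)
    obtain a b where ab: "\<And>x y. d * y\<^sup>2 = poly f x \<Longrightarrow> h (x, y) = poly a x + poly b x * y"
      using hI(1) by (auto elim: regularE)
    \<comment> \<open>The norm of \<open>a + b y\<close>: a multiple of the denominator
      \<open>h\<close> that depends on \<open>x\<close> alone.\<close>
    define w where "w = a\<^sup>2 - smult (1 / d) (b\<^sup>2 * f)"
    have w: "poly w x' = (poly a x' - poly b x' * y') * h (x', y')" if "d * y'\<^sup>2 = poly f x'" for x' y'
    proof -
      have "poly (smult (1 / d) (b\<^sup>2 * f)) x' = (poly b x')\<^sup>2 * y'\<^sup>2"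
        using d by (simp flip: that)
      then show ?thesis by (simp add: w_def ab[OF that] power2_eq_square algebra_simps)
    qed
    have "regular d f (\<lambda>P. poly w (fst P) * u P)"
    proof (rule regular_cong)
      show "regular d f (\<lambda>P. (poly a (fst P) + poly (- b) (fst P) * snd P) * (u P * h P))"
        by (intro regular_mult[OF _ hI(2)] regular_add regular_mult[OF regular_poly regular_snd] regular_poly d)
      fix P assume "P \<in> affine_points d f"
      then have "d * (snd P)\<^sup>2 = poly f (fst P)" by (auto simp: affine_points_def)
      from w[OF this] show "poly w (fst P) * u P = (poly a (fst P) + poly (- b) (fst P) * snd P) * (u P * h P)"
        by simp
    qed
    moreover have "poly w x \<noteq> 0"
      using w[OF y] h ab[of "- y" x] y by simp
    ultimately show ?thesis by (auto simp: W_def)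
  qed
  \<comment> \<open>A non-zero element of least degree generates the ideal \<open>W\<close>; as
    \<open>W\<close> has no common zero, it must be constant.\<close>
  define w where "w = arg_min Polynomial.degree (\<lambda>w. w \<in> W \<and> w \<noteq> 0)"
  have "\<exists>w. w \<in> W \<and> w \<noteq> 0" using W_nz[of 0] by auto
  then have w: "w \<in> W" "w \<noteq> 0" and min: "\<And>v. v \<in> W \<Longrightarrow> v \<noteq> 0 \<Longrightarrow> Polynomial.degree w \<le> Polynomial.degree v"
    unfolding w_def using arg_min_natI[of "\<lambda>w. w \<in> W \<and> w \<noteq> 0"] arg_min_nat_le[of "\<lambda>w. w \<in> W \<and> w \<noteq> 0"] by blast+
  have dvd: "w dvd v" if "v \<in> W" for v
  proof -
    have "regular d f (\<lambda>P. poly v (fst P) * u P + poly (- (v div w)) (fst P) * (poly w (fst P) * u P))"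
      using regular_add[OF _ regular_mult[OF regular_poly _ d]] that w(1) unfolding W_def mem_Collect_eq by blast
    moreover have "poly v x = poly (v div w) x * poly w x + poly (v mod w) x" for x
      by (metis div_mult_mod_eq poly_add poly_mult)
    ultimately have "v mod w \<in> W"
      unfolding W_def mem_Collect_eq by (elim regular_cong) (simp add: algebra_simps)
    then have "v mod w = 0" using min degree_mod_less'[of w v] w(2) by force
    then show ?thesis by (simp add: dvd_eq_mod_eq_0)
  qed
  have "Polynomial.degree w = 0"
  proof (rule ccontr)
    assume "Polynomial.degree w \<noteq> 0"
    then obtain x where "poly w x = 0" using alg_closed_imp_poly_has_root[of w] by auto
    moreover obtain v where v: "v \<in> W" "poly v x \<noteq> 0" using W_nz by blast
    ultimately show False using dvd[OF v(1)] by (auto elim: dvdE)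
  qed
  then obtain k where k: "w = [:k:]" by (rule degree_eq_zeroE)
  then have "k \<noteq> 0" using w by simp
  have "regular d f (\<lambda>P. (1 / k) * (poly w (fst P) * u P))"
    using regular_mult[OF regular_const _ d] w(1) unfolding W_def mem_Collect_eq by blast
  then show ?thesis using \<open>k \<noteq> 0\<close> by (simp add: k)
qed

lemma form_eval_homogeneous:
  "form_eval m A (c * x, c * y, c * z) = c ^ m * form_eval m A (x, y, z)"
proof -
  have "to_ac (A i j) * (c * x) ^ i * (c * y) ^ j * (c * z) ^ (m - i - j)
      = c ^ m * (to_ac (A i j) * x ^ i * y ^ j * z ^ (m - i - j))" if "i \<le> m" "j \<le> m - i" for i j
  proof -
    have "c ^ m = c ^ i * c ^ j * c ^ (m - i - j)" using that by (simp flip: power_add)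
    then show ?thesis by (simp add: power_mult_distrib mult_ac)
  qed
  then show ?thesis unfolding form_eval_def prod.case sum_distrib_left by (intro sum.cong refl) auto
qed



text \<open>In a finite field the product of all \<open>X - u\<close>, plus 1, would be non-constant
  without a root.\<close>

lemma infinite_UNIV_alg_closed: "infinite (UNIV :: 'k::alg_closed_field set)"
proof
  assume fin: "finite (UNIV :: 'k set)"
  define q where "q = (\<Prod>u\<in>(UNIV::'k set). [:- u, 1:]) + 1"
  have "poly q x = 1" for x
  proof -
    have "(\<Prod>u\<in>UNIV. x - u) = 0" using fin by (intro prod_zero) (auto intro!: bexI[of _ x])
    then show ?thesis by (simp add: q_def poly_prod)
  qed
  moreover have "Polynomial.degree q > 0"
  proof -
    have "Polynomial.degree (\<Prod>u\<in>(UNIV::'k set). [:- u, 1:]) = (\<Sum>u\<in>(UNIV::'k set). 1)"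
      by (subst degree_prod_eq_sum_degree) auto
    then have "Polynomial.degree (\<Prod>u\<in>(UNIV::'k set). [:- u, 1:]) > 0"
      using finite_UNIV_card_ge_0[OF fin] by (simp only: sum_constant mult_1_right of_nat_id)
    then show ?thesis unfolding q_def by (simp add: degree_add_eq_left)
  qed
  ultimately show False using alg_closed_imp_poly_has_root[of q] by auto
qed

lemma poly_eqI_alg_closed:
  fixes a b :: "'k::alg_closed_field poly"
  assumes "\<And>x. poly a x = poly b x"
  shows "a = b"
proof (rule ccontr)
  assume "a \<noteq> b"
  then have "finite {x. poly (a - b) x = 0}" by (intro poly_roots_finite) simp
  moreover have "{x. poly (a - b) x = 0} = UNIV" using assms by simp
  ultimately show False using infinite_UNIV_alg_closed by metis
qed

section \<open>Pole orders at the origin\<close>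

text \<open>The weights are 2 for \<open>x\<close> and 3 for \<open>y\<close>. For
  \<open>b \<noteq> 0\<close> the entries of \<open>max\<close> have different parity, so leading
  terms cannot cancel. The test \<open>b = 0\<close> guards against the zero polynomial, whose
  degree is 0 here and would count as 3.\<close>

definition pole_order :: "'k::field poly \<Rightarrow> ('k \<times> 'k \<Rightarrow> 'k) \<Rightarrow> nat \<Rightarrow> bool" where
  "pole_order f u n \<longleftrightarrow> (\<exists>a b. (\<forall>x y. y\<^sup>2 = poly f x \<longrightarrow> u (x, y) = poly a x + poly b x * y) \<and>
     (a \<noteq> 0 \<or> b \<noteq> 0) \<and> n = max (2 * Polynomial.degree a) (if b = 0 then 0 else 2 * Polynomial.degree b + 3))"

lemma pole_orderI:
  assumes "\<And>x y. y\<^sup>2 = poly f x \<Longrightarrow> u (x, y) = poly a x + poly b x * y" "a \<noteq> 0 \<or> b \<noteq> 0"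
    "n = max (2 * Polynomial.degree a) (if b = 0 then 0 else 2 * Polynomial.degree b + 3)"
  shows "pole_order f u n"
  using assms unfolding pole_order_def by blast

lemma pole_order_cong:
  assumes "pole_order f u n" "\<And>x y. y\<^sup>2 = poly f x \<Longrightarrow> w (x, y) = u (x, y)"
  shows "pole_order f w n"
  using assms unfolding pole_order_def by auto

text \<open>Evaluation at \<open>(x, y)\<close> and \<open>(x, - y)\<close> separates the part
  without \<open>y\<close> from the part with it, as 2 is invertible.\<close>

lemma affine_coordinates_unique:
  fixes f :: "'k::alg_closed_field poly"
  assumes f: "f \<noteq> 0" and two: "(2::'k) \<noteq> 0"
    and eq: "\<And>x y. y\<^sup>2 = poly f x \<Longrightarrow> poly a x + poly b x * y = poly a' x + poly b' x * y"
  shows "a = a' \<and> b = b'"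
proof -
  have *: "poly (a - a') x = 0 \<and> poly ((b - b')\<^sup>2 * f) x = 0" for x
  proof -
    obtain y where y: "y\<^sup>2 = poly f x" using exists_snd[of 1 f x] by auto
    have e: "poly (a - a') x = - (poly (b - b') x * y)" "poly (a - a') x = poly (b - b') x * y"
      using eq[of y x] eq[of "- y" x] y by (simp_all add: algebra_simps)
    then have "2 * poly (a - a') x = 0" unfolding mult_2 by (metis add.left_inverse)
    then have z: "poly (a - a') x = 0" using two by simp
    then have "(poly (b - b') x * y)\<^sup>2 = 0" using e by simp
    then show ?thesis using z by (simp add: power_mult_distrib y del: power_eq_0_iff)
  qed
  have "a - a' = 0" using * by (intro poly_eqI_alg_closed) simp
  moreover have "(b - b')\<^sup>2 * f = 0" using * by (intro poly_eqI_alg_closed) simp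
  ultimately show ?thesis using f by simp
qed

text \<open>When non-zero, \<open>a\<^sup>2\<close> has even and \<open>b\<^sup>2 * f\<close> odd
  degree, so they cannot cancel. The norm of \<open>a + b y\<close> thus computes its pole order,
  and multiplicativity of norms becomes additivity of orders.\<close>

lemma degree_affine_norm:
  fixes f :: "'k::field poly"
  assumes "Polynomial.degree f = 3" "a \<noteq> 0 \<or> b \<noteq> 0"
  shows "Polynomial.degree (a\<^sup>2 - b\<^sup>2 * f) = max (2 * Polynomial.degree a) (if b = 0 then 0 else 2 * Polynomial.degree b + 3)"
    and "a\<^sup>2 - b\<^sup>2 * f \<noteq> 0"
proof -
  have f0: "f \<noteq> 0" using assms(1) by auto
  show deg: "Polynomial.degree (a\<^sup>2 - b\<^sup>2 * f) = max (2 * Polynomial.degree a) (if b = 0 then 0 else 2 * Polynomial.degree b + 3)"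
  proof (cases "b = 0")
    case True
    then show ?thesis using assms(2) by (simp add: degree_power_eq)
  next
    case False
    then have b: "Polynomial.degree (- (b\<^sup>2 * f)) = 2 * Polynomial.degree b + 3"
      using f0 assms(1) by (simp add: degree_mult_eq degree_power_eq)
    have a: "Polynomial.degree (a\<^sup>2) = 2 * Polynomial.degree a"
      by (cases "a = 0") (simp_all add: degree_power_eq)
    have ne: "2 * Polynomial.degree a \<noteq> 2 * Polynomial.degree b + 3" by presburger
    show ?thesis
      using degree_add_eq_left[of "- (b\<^sup>2 * f)" "a\<^sup>2"] degree_add_eq_right[of "a\<^sup>2" "- (b\<^sup>2 * f)"] ne False
      unfolding a b diff_conv_add_uminus by (auto simp: max_def)
  qed
  show "a\<^sup>2 - b\<^sup>2 * f \<noteq> 0"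
  proof (cases "b = 0")
    case False
    then have "Polynomial.degree (a\<^sup>2 - b\<^sup>2 * f) > 0" using deg by simp
    then show ?thesis by auto
  qed (use assms(2) in simp)
qed

lemma pole_order_unique:
  fixes f :: "'k::alg_closed_field poly"
  assumes f: "f \<noteq> 0" "(2::'k) \<noteq> 0" and "pole_order f u m" "pole_order f u n"
  shows "m = n"
proof -
  obtain a b where ab: "\<And>x y. y\<^sup>2 = poly f x \<Longrightarrow> u (x, y) = poly a x + poly b x * y" "a \<noteq> 0 \<or> b \<noteq> 0"
    "m = max (2 * Polynomial.degree a) (if b = 0 then 0 else 2 * Polynomial.degree b + 3)"
    using assms(3) unfolding pole_order_def by blast
  obtain a' b' where ab': "\<And>x y. y\<^sup>2 = poly f x \<Longrightarrow> u (x, y) = poly a' x + poly b' x * y" "a' \<noteq> 0 \<or> b' \<noteq> 0"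
    "n = max (2 * Polynomial.degree a') (if b' = 0 then 0 else 2 * Polynomial.degree b' + 3)"
    using assms(4) unfolding pole_order_def by blast
  have "a = a' \<and> b = b'" using ab(1) ab'(1) by (intro affine_coordinates_unique[OF f]) simp
  then show ?thesis using ab(3) ab'(3) by simp
qed

lemma not_pole_order_zero:
  fixes f :: "'k::alg_closed_field poly"
  assumes f: "f \<noteq> 0" "(2::'k) \<noteq> 0" and "\<And>x y. y\<^sup>2 = poly f x \<Longrightarrow> u (x, y) = 0"
  shows "\<not> pole_order f u m"
proof
  assume "pole_order f u m"
  then obtain a b where ab: "\<And>x y. y\<^sup>2 = poly f x \<Longrightarrow> u (x, y) = poly a x + poly b x * y" "a \<noteq> 0 \<or> b \<noteq> 0"
    unfolding pole_order_def by blast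
  have "a = 0 \<and> b = 0" using ab(1) assms(3) by (intro affine_coordinates_unique[OF f]) simp
  then show False using ab(2) by simp
qed

lemma pole_order_const: "c \<noteq> 0 \<Longrightarrow> pole_order f (\<lambda>_. c) 0"
  by (rule pole_orderI[of _ _ "[:c:]" 0]) auto

lemma pole_order_fst: "pole_order f fst 2"
  by (rule pole_orderI[of _ _ "[:0, 1:]" 0]) auto

lemma pole_order_snd: "pole_order f snd 3"
  by (rule pole_orderI[of _ _ 0 1]) auto

lemma regular_cases:
  assumes "regular 1 f u"
  obtains "\<And>x y. y\<^sup>2 = poly f x \<Longrightarrow> u (x, y) = 0" | n where "pole_order f u n"
proof -
  obtain a b where ab: "\<And>x y. y\<^sup>2 = poly f x \<Longrightarrow> u (x, y) = poly a x + poly b x * y"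
    using assms by (auto elim: regularE)
  then show thesis using that pole_orderI[of f u a b] by (cases "a = 0 \<and> b = 0") force+
qed

lemma pole_order_add:
  assumes "pole_order f u m" "pole_order f w n" "m < n"
  shows "pole_order f (\<lambda>P. u P + w P) n"
proof -
  obtain a b where ab: "\<And>x y. y\<^sup>2 = poly f x \<Longrightarrow> u (x, y) = poly a x + poly b x * y" "a \<noteq> 0 \<or> b \<noteq> 0"
    "m = max (2 * Polynomial.degree a) (if b = 0 then 0 else 2 * Polynomial.degree b + 3)"
    using assms(1) unfolding pole_order_def by blast
  obtain a' b' where ab': "\<And>x y. y\<^sup>2 = poly f x \<Longrightarrow> w (x, y) = poly a' x + poly b' x * y" "a' \<noteq> 0 \<or> b' \<noteq> 0"
    "n = max (2 * Polynomial.degree a') (if b' = 0 then 0 else 2 * Polynomial.degree b' + 3)"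
    using assms(2) unfolding pole_order_def by blast
  have n: "n = max (2 * Polynomial.degree (a + a')) (if b + b' = 0 then 0 else 2 * Polynomial.degree (b + b') + 3)"
  proof (cases "n = 2 * Polynomial.degree a'")
    case True
    then have "Polynomial.degree (a + a') = Polynomial.degree a'"
      using ab(3) assms(3) by (intro degree_add_eq_right) (auto simp: max_def split: if_splits)
    moreover have "2 * Polynomial.degree (b + b') + 3 \<le> n" if "b + b' \<noteq> 0"
    proof (cases "b' = 0")
      case True
      then show ?thesis using that ab(3) assms(3) by (auto simp: max_def split: if_splits)
    next
      case False
      then have "2 * Polynomial.degree b' + 3 \<le> n" using ab'(3) by (simp add: max_def split: if_splits)
      moreover have "2 * Polynomial.degree b + 3 \<le> n \<or> b = 0" using ab(3) assms(3) by (auto simp: max_def split: if_splits)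
      moreover have "Polynomial.degree (b + b') \<le> max (Polynomial.degree b) (Polynomial.degree b')"
        by (rule degree_add_le_max)
      ultimately show ?thesis by (auto simp: max_def split: if_splits)
    qed
    ultimately show ?thesis using True by (auto simp: max_def)
  next
    case False
    then have n: "b' \<noteq> 0" "n = 2 * Polynomial.degree b' + 3" "2 * Polynomial.degree a' \<le> n"
      using ab'(3) assms(3) by (auto simp: max_def split: if_splits)
    have d: "Polynomial.degree b < Polynomial.degree b' \<or> b = 0"
      using ab(3) assms(3) n(2) by (auto simp: max_def split: if_splits)
    then have "Polynomial.degree (b + b') = Polynomial.degree b'" by (auto intro: degree_add_eq_right)
    moreover have "b + b' \<noteq> 0" using d n(1) by (auto simp: add_eq_0_iff)
    moreover have "2 * Polynomial.degree a \<le> n" using ab(3) assms(3) by (simp add: max_def split: if_splits)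
    then have "2 * Polynomial.degree (a + a') \<le> n"
      using n(3) degree_add_le_max[of a a'] by (simp add: max_def split: if_splits)
    ultimately show ?thesis using n(2) by (simp add: max_def)
  qed
  moreover from n have "a + a' \<noteq> 0 \<or> b + b' \<noteq> 0" using assms(3) by auto
  ultimately show ?thesis
    using ab(1) ab'(1) by (intro pole_orderI[of _ _ "a + a'" "b + b'"]) (simp_all add: algebra_simps)
qed

lemma pole_order_mult:
  fixes f :: "'k::field poly"
  assumes f: "Polynomial.degree f = 3" and "pole_order f u m" "pole_order f w n"
  shows "pole_order f (\<lambda>P. u P * w P) (m + n)"
proof -
  obtain a b where ab: "\<And>x y. y\<^sup>2 = poly f x \<Longrightarrow> u (x, y) = poly a x + poly b x * y" "a \<noteq> 0 \<or> b \<noteq> 0"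
    "m = max (2 * Polynomial.degree a) (if b = 0 then 0 else 2 * Polynomial.degree b + 3)"
    using assms(2) unfolding pole_order_def by blast
  obtain a' b' where ab': "\<And>x y. y\<^sup>2 = poly f x \<Longrightarrow> w (x, y) = poly a' x + poly b' x * y" "a' \<noteq> 0 \<or> b' \<noteq> 0"
    "n = max (2 * Polynomial.degree a') (if b' = 0 then 0 else 2 * Polynomial.degree b' + 3)"
    using assms(3) unfolding pole_order_def by blast
  define a2 b2 where "a2 = a * a' + b * b' * f" and "b2 = a * b' + a' * b"
  have N: "a2\<^sup>2 - b2\<^sup>2 * f = (a\<^sup>2 - b\<^sup>2 * f) * (a'\<^sup>2 - b'\<^sup>2 * f)"
    by (simp add: a2_def b2_def power2_eq_square algebra_simps)
  note d = degree_affine_norm[OF f]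
  have nz: "a2 \<noteq> 0 \<or> b2 \<noteq> 0"
    using N d(2)[OF ab(2)] d(2)[OF ab'(2)] by auto
  have "Polynomial.degree (a2\<^sup>2 - b2\<^sup>2 * f) = m + n"
    unfolding N using d(2)[OF ab(2)] d(2)[OF ab'(2)] by (simp add: degree_mult_eq d(1)[OF ab(2)] d(1)[OF ab'(2)] ab(3) ab'(3))
  then have mn: "m + n = max (2 * Polynomial.degree a2) (if b2 = 0 then 0 else 2 * Polynomial.degree b2 + 3)"
    using d(1)[OF nz] by simp
  show ?thesis
  proof (rule pole_orderI[OF _ nz mn])
    fix x y assume xy: "y\<^sup>2 = poly f x"
    show "u (x, y) * w (x, y) = poly a2 x + poly b2 x * y"
      unfolding ab(1)[OF xy] ab'(1)[OF xy] a2_def b2_def poly_add poly_mult xy[symmetric]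
      by (simp add: power2_eq_square algebra_simps)
  qed
qed

text \<open>Horner's scheme: \<open>n > 0\<close> puts each added constant strictly below the order
  of the product.\<close>

lemma pole_order_poly:
  fixes f :: "'k::field poly"
  assumes f: "Polynomial.degree f = 3" and u: "pole_order f u n" "n > 0" and A: "A \<noteq> 0"
  shows "pole_order f (\<lambda>P. poly A (u P)) (n * Polynomial.degree A)"
  using A
proof (induction A)
  case (pCons a A)
  show ?case
  proof (cases "A = 0")
    case True
    then show ?thesis using pCons.hyps pole_order_const[of a f] by simp
  next
    case False
    then have 1: "pole_order f (\<lambda>P. u P * poly A (u P)) (n * Polynomial.degree (pCons a A))"
      using pole_order_mult[OF f u(1) pCons.IH] by (simp add: algebra_simps)
    show ?thesis
    proof (cases "a = 0")
      case True
      then show ?thesis using 1 by simp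
    next
      case a: False
      have "0 < n * Polynomial.degree (pCons a A)" using u(2) False by simp
      from pole_order_add[OF pole_order_const[OF a] 1 this] show ?thesis by simp
    qed
  qed
qed simp

text \<open>
  Orders of poles at the origin: \<open>x\<close> and \<open>y\<close> have orders \<open>2\<close> and \<open>3\<close>, while every polynomial
  expression in \<open>u\<close> and \<open>w\<close> has order divisible by \<open>m\<close>, where \<open>u\<close> and \<open>w\<close> have orders \<open>2m\<close> and \<open>3m\<close>.
\<close>

lemma generating_coordinates_affine:
  fixes f :: "'k::alg_closed_field poly"
  assumes f: "Polynomial.degree f = 3" and two: "(2::'k) \<noteq> 0" and e: "e \<noteq> 0"
    and reg: "regular 1 f u" "regular 1 f w"
    and eq: "\<And>x y. y\<^sup>2 = poly f x \<Longrightarrow> e * (w (x, y))\<^sup>2 = u (x, y) ^ 3 - u (x, y)"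
    and gen_x: "\<And>x y. y\<^sup>2 = poly f x \<Longrightarrow> x = poly A (u (x, y)) + poly B (u (x, y)) * w (x, y)"
    and gen_y: "\<And>x y. y\<^sup>2 = poly f x \<Longrightarrow> y = poly A' (u (x, y)) + poly B' (u (x, y)) * w (x, y)"
  shows "\<exists>\<alpha> \<beta> \<kappa>. \<alpha> \<noteq> 0 \<and> \<kappa> \<noteq> 0 \<and> (\<forall>x y. y\<^sup>2 = poly f x \<longrightarrow> u (x, y) = \<alpha> * x + \<beta>) \<and>
    (\<forall>x. \<kappa> * poly f x = (\<alpha> * x + \<beta>) ^ 3 - (\<alpha> * x + \<beta>))"
proof -
  have f0: "f \<noteq> 0" using f by auto
  note unique = pole_order_unique[OF f0 two] and not_zero = not_pole_order_zero[OF f0 two]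
  \<comment> \<open>For constant \<open>u\<close> the square of \<open>w\<close> is constant too,
    and \<open>gen_x\<close> would make the square of \<open>x - t\<close> the same for all
    \<open>x\<close>.\<close>
  have const: False if "\<And>x y. y\<^sup>2 = poly f x \<Longrightarrow> u (x, y) = c" for c
  proof -
    define t where "t = poly A c"
    define s where "s = (poly B c)\<^sup>2 * ((c ^ 3 - c) / e)"
    have "(x - t)\<^sup>2 = s" for x
    proof -
      obtain y where y: "y\<^sup>2 = poly f x" using exists_snd[of 1 f x] by auto
      have "(w (x, y))\<^sup>2 = (c ^ 3 - c) / e" using eq[OF y] that[OF y] e by (simp add: field_simps)
      moreover have "x = t + poly B c * w (x, y)" using gen_x[OF y] that[OF y] by (simp add: t_def)
      then have "x - t = poly B c * w (x, y)" by (metis add_diff_cancel_left')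
      ultimately show ?thesis by (simp add: s_def power_mult_distrib)
    qed
    from this[of t] this[of "t + 1"] show False by simp
  qed
  obtain j where j: "pole_order f u j"
    using regular_cases[OF reg(1)] const by metis
  have "j \<noteq> 0"
  proof
    assume "j = 0"
    with j have "pole_order f u 0" by simp
    then obtain a b where ab: "\<And>x y. y\<^sup>2 = poly f x \<Longrightarrow> u (x, y) = poly a x + poly b x * y"
      "0 = max (2 * Polynomial.degree a) (if b = 0 then 0 else 2 * Polynomial.degree b + 3)"
      unfolding pole_order_def by blast
    from ab(2) have b: "b = 0" and "Polynomial.degree a = 0" by (auto simp: max_def split: if_splits)
    then obtain c where "a = [:c:]" by (auto elim: degree_eq_zeroE)
    then show False using const[of c] ab(1) b by simp
  qed
  then have j0: "j > 0" by simp
  have "pole_order f (\<lambda>P. poly [:0, - 1, 0, 1:] (u P)) (j * 3)"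
  proof -
    have "[:0, - 1, 0, 1:] \<noteq> (0::'k poly)" "Polynomial.degree [:0, - 1, 0, 1::'k:] = 3" by simp_all
    then show ?thesis using pole_order_poly[OF f j j0] by metis
  qed
  then have p3: "pole_order f (\<lambda>P. e * (w P * w P)) (j * 3)"
  proof (rule pole_order_cong)
    fix x y assume "y\<^sup>2 = poly f x"
    from eq[OF this] show "e * (w (x, y) * w (x, y)) = poly [:0, - 1, 0, 1:] (u (x, y))"
      by (simp add: power2_eq_square power3_eq_cube algebra_simps)
  qed
  obtain k where k: "pole_order f w k"
  proof (rule regular_cases[OF reg(2)])
    assume "\<And>x y. y\<^sup>2 = poly f x \<Longrightarrow> w (x, y) = 0"
    then show thesis using not_zero[of "\<lambda>P. e * (w P * w P)"] p3 by simp
  qed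
  have "pole_order f (\<lambda>P. e * (w P * w P)) (0 + (k + k))"
    by (intro pole_order_mult[OF f] pole_order_const e k)
  then have jk: "j * 3 = 2 * k" using unique[OF p3] by simp
  define m where "m = k - j"
  have m: "j = 2 * m" "k = 3 * m" "m > 0" using jk j0 by (auto simp: m_def)
  have dvd: "m dvd t" if t: "pole_order f v t"
    and v: "\<And>x y. y\<^sup>2 = poly f x \<Longrightarrow> v (x, y) = poly A (u (x, y)) + poly B (u (x, y)) * w (x, y)" for v t A B
  proof -
    have v': "pole_order f v n" if "pole_order f (\<lambda>P. poly A (u P) + poly B (u P) * w P) n" for n
      using that by (rule pole_order_cong) (rule v)
    have PA: "pole_order f (\<lambda>P. poly A (u P)) (j * Polynomial.degree A)" if "A \<noteq> 0"
      by (rule pole_order_poly[OF f j j0 that])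
    have PB: "pole_order f (\<lambda>P. poly B (u P) * w P) (j * Polynomial.degree B + k)" if "B \<noteq> 0"
      by (rule pole_order_mult[OF f pole_order_poly[OF f j j0 that] k])
    consider "A = 0" "B = 0" | "A = 0" "B \<noteq> 0" | "A \<noteq> 0" "B = 0" | "A \<noteq> 0" "B \<noteq> 0" by blast
    then show ?thesis
    proof cases
      case 1
      then show ?thesis using not_zero[of v] v t by simp
    next
      case 2
      then have "t = j * Polynomial.degree B + k" using unique[OF t v'] PB by simp
      then show ?thesis by (simp add: m)
    next
      case 3
      then have "t = j * Polynomial.degree A" using unique[OF t v'] PA by simp
      then show ?thesis by (simp add: m)
    next
      case 4
      \<comment> \<open>One side is an even multiple of \<open>m\<close>, the other an odd one, so
        the larger order survives in the sum.\<close>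
      have "j * Polynomial.degree A \<noteq> j * Polynomial.degree B + k"
      proof
        assume "j * Polynomial.degree A = j * Polynomial.degree B + k"
        then have "m * (2 * Polynomial.degree A) = m * (2 * Polynomial.degree B + 3)"
          by (simp add: m algebra_simps)
        then have "2 * Polynomial.degree A = 2 * Polynomial.degree B + 3" using m(3) by simp
        then show False by presburger
      qed
      then consider "j * Polynomial.degree A < j * Polynomial.degree B + k"
        | "j * Polynomial.degree B + k < j * Polynomial.degree A" by linarith
      then show ?thesis
      proof cases
        case 1
        then have "t = j * Polynomial.degree B + k"
          by (intro unique[OF t v'] pole_order_add[OF PA[OF 4(1)] PB[OF 4(2)]])
        then show ?thesis by (simp add: m)
      next
        case 2
        have "t = j * Polynomial.degree A"
          using pole_order_add[OF PB[OF 4(2)] PA[OF 4(1)] 2] by (intro unique[OF t v']) (simp add: add.commute)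
        then show ?thesis by (simp add: m)
      qed
    qed
  qed
  \<comment> \<open>The coordinates \<open>x\<close> and \<open>y\<close> are expressions in
    \<open>u\<close> and \<open>w\<close>, and their orders 2 and 3 are coprime.\<close>
  have "m dvd 2" by (rule dvd[OF pole_order_fst]) (simp, rule gen_x)
  moreover have "m dvd 3" by (rule dvd[OF pole_order_snd]) (simp, rule gen_y)
  ultimately have "m dvd 3 - 2" by (rule dvd_diff_nat[rotated])
  then have m1: "j = 2" "k = 3" by (simp_all add: m)
  obtain a b where ab: "\<And>x y. y\<^sup>2 = poly f x \<Longrightarrow> u (x, y) = poly a x + poly b x * y"
    "2 = max (2 * Polynomial.degree a) (if b = 0 then 0 else 2 * Polynomial.degree b + 3)"
    using j unfolding m1 pole_order_def by blast
  have b0: "b = 0" and deg_a: "Polynomial.degree a = 1"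
    using ab(2) by (auto simp: max_def split: if_splits)
  define \<alpha> \<beta> where "\<alpha> = Polynomial.coeff a 1" and "\<beta> = Polynomial.coeff a 0"
  have \<alpha>0: "\<alpha> \<noteq> 0" using deg_a leading_coeff_0_iff[of a] by (auto simp: \<alpha>_def)
  have "poly a x = \<alpha> * x + \<beta>" for x
    by (simp add: poly_altdef deg_a \<alpha>_def \<beta>_def)
  then have u: "u (x, y) = \<alpha> * x + \<beta>" if "y\<^sup>2 = poly f x" for x y using ab(1)[OF that] b0 by simp
  obtain a' b' where w: "\<And>x y. y\<^sup>2 = poly f x \<Longrightarrow> w (x, y) = poly a' x + poly b' x * y"
    "3 = max (2 * Polynomial.degree a') (if b' = 0 then 0 else 2 * Polynomial.degree b' + 3)"
    using k unfolding m1 pole_order_def by blast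
  have "(3::nat) \<noteq> 2 * Polynomial.degree a'" by presburger
  then have b'0: "b' \<noteq> 0" and "Polynomial.degree b' = 0"
    using w(2) by (auto simp: max_def split: if_splits)
  then obtain \<gamma> where \<gamma>: "b' = [:\<gamma>:]" "\<gamma> \<noteq> 0" by (auto elim: degree_eq_zeroE)
  \<comment> \<open>Replacing \<open>y\<close> by \<open>- y\<close> stays on the curve; the
    difference of the two equations isolates the cross term, whose vanishing gives
    \<open>a' = 0\<close> below.\<close>
  have sq: "e * (poly a' x)\<^sup>2 + e * \<gamma>\<^sup>2 * poly f x = (\<alpha> * x + \<beta>) ^ 3 - (\<alpha> * x + \<beta>)"
    and cross: "poly a' x * y = 0" if y: "y\<^sup>2 = poly f x" for x y
  proof -
    have y': "(- y)\<^sup>2 = poly f x" using y by simp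
    have plus: "e * (poly a' x + \<gamma> * y)\<^sup>2 = (\<alpha> * x + \<beta>) ^ 3 - (\<alpha> * x + \<beta>)"
      using eq[OF y] by (simp add: u[OF y] w(1)[OF y] \<gamma>)
    moreover have "e * (poly a' x - \<gamma> * y)\<^sup>2 = (\<alpha> * x + \<beta>) ^ 3 - (\<alpha> * x + \<beta>)"
      using eq[OF y'] by (simp add: u[OF y'] w(1)[OF y'] \<gamma>)
    ultimately have "e * ((poly a' x + \<gamma> * y)\<^sup>2 - (poly a' x - \<gamma> * y)\<^sup>2) = 0"
      by (simp add: right_diff_distrib)
    moreover have "(poly a' x + \<gamma> * y)\<^sup>2 - (poly a' x - \<gamma> * y)\<^sup>2 = 2 * (2 * (\<gamma> * (poly a' x * y)))"
      by (simp add: power2_eq_square algebra_simps)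
    ultimately have "e * (2 * (2 * (\<gamma> * (poly a' x * y)))) = 0" by (simp only:)
    then show cr: "poly a' x * y = 0" using e two \<gamma>(2) by (simp only: mult_eq_0_iff) blast
    have "(poly a' x + \<gamma> * y)\<^sup>2 = (poly a' x)\<^sup>2 + \<gamma>\<^sup>2 * y\<^sup>2 + 2 * \<gamma> * (poly a' x * y)"
      by (simp add: power2_eq_square algebra_simps)
    then show "e * (poly a' x)\<^sup>2 + e * \<gamma>\<^sup>2 * poly f x = (\<alpha> * x + \<beta>) ^ 3 - (\<alpha> * x + \<beta>)"
      using plus unfolding cr y by (simp add: algebra_simps)
  qed
  have "a'\<^sup>2 * f = 0"
  proof (rule poly_eqI_alg_closed)
    fix x
    obtain y where y: "y\<^sup>2 = poly f x" using exists_snd[of 1 f x] by auto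
    have "(poly a' x * y)\<^sup>2 = 0" using cross[OF y] by simp
    then show "poly (a'\<^sup>2 * f) x = poly 0 x" by (simp only: power_mult_distrib y poly_mult poly_power poly_0)
  qed
  then have a'0: "a' = 0" using f0 by simp
  have "\<forall>x. e * \<gamma>\<^sup>2 * poly f x = (\<alpha> * x + \<beta>) ^ 3 - (\<alpha> * x + \<beta>)"
  proof
    fix x
    obtain y where y: "y\<^sup>2 = poly f x" using exists_snd[of 1 f x] by auto
    show "e * \<gamma>\<^sup>2 * poly f x = (\<alpha> * x + \<beta>) ^ 3 - (\<alpha> * x + \<beta>)" using sq[OF y] a'0 by simp
  qed
  moreover have "e * \<gamma>\<^sup>2 \<noteq> 0" using e \<gamma> by simp
  ultimately show ?thesis using \<alpha>0 u by blast
qed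

section \<open>Affine coordinates of morphisms\<close>

lemma hcoord_affine_mem_proj_points:
  assumes "Polynomial.degree f = 3"
  shows "hcoord (x, y, 1) \<in> proj_points d f \<longleftrightarrow> (x, y) \<in> affine_points d f"
  by (simp add: hcoord_mem_proj_points affine_points_def poly_altdef assms)

lemma proj_points_affine_cases:
  assumes f: "Polynomial.degree f = 3" and P: "P \<in> proj_points d f" "P \<noteq> origin"
  obtains x y where "P = hcoord (x, y, 1)" "(x, y) \<in> affine_points d f"
proof -
  obtain x y z where xyz: "P = hcoord (x, y, z)" using P(1) unfolding proj_points_def by blast
  then have eq: "(x, y, z) \<noteq> (0, 0, 0)" "d * y ^ 2 * z = (\<Sum>i\<le>3. Polynomial.coeff f i * x ^ i * z ^ (3 - i))"
    using P(1) hcoord_mem_proj_points by blast+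
  show thesis
  proof (cases "z = 0")
    case True
    have "Polynomial.coeff f 3 \<noteq> 0" using f leading_coeff_0_iff[of f] by auto
    then have "x = 0" using eq(2) True by (simp add: eval_nat_numeral)
    then have "P = origin" using eq(1) True unfolding xyz origin_def hcoord_eq_iff
      by (auto intro!: exI[of _ "1 / y"])
    then show thesis using P(2) by simp
  next
    case False
    then have "P = hcoord (x / z, y / z, 1)"
      unfolding xyz hcoord_eq_iff by (auto intro!: exI[of _ "1 / z"])
    moreover from this P(1) have "(x / z, y / z) \<in> affine_points d f"
      using hcoord_affine_mem_proj_points[OF f] by metis
    ultimately show thesis by (rule that)
  qed
qed

text \<open>This is where coefficients in the base field matter: they are fixed by the power map, so
  forms commute with it.\<close>

lemma form_eval_power:
  fixes A :: "nat \<Rightarrow> nat \<Rightarrow> 'a::field"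
  assumes add: "\<And>a b :: 'a alg_closure. (a + b) ^ Q = a ^ Q + b ^ Q"
    and fixed: "\<And>a::'a. to_ac a ^ Q = to_ac a" and "Q > 0"
  shows "form_eval m A (x ^ Q, y ^ Q, z ^ Q) = form_eval m A (x, y, z) ^ Q"
proof -
  have sum_pow: "sum h I ^ Q = (\<Sum>i\<in>I. h i ^ Q)" for h :: "nat \<Rightarrow> 'a alg_closure" and I
    using assms(3) by (induction I rule: infinite_finite_induct) (simp_all add: add)
  show ?thesis
    unfolding form_eval_def prod.case
    by (simp only: sum_pow power_mult_distrib fixed power_mult[symmetric] mult.commute[of Q])
qed

text \<open>Around each point \<open>u\<close> and \<open>w\<close> are quotients
  \<open>A\<^sub>0 / A\<^sub>2\<close> and \<open>A\<^sub>1 / A\<^sub>2\<close> of forms, and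
  \<open>locally_regular_imp_regular\<close> makes them polynomial. That step yields coefficients in
  the closure only; the rationality of the forms is retained as compatibility of \<open>u\<close>
  with Frobenius, the last conclusion.\<close>

lemma morphism_coordinates:
  fixes d e :: "'a::field alg_closure" and f g :: "'a alg_closure poly"
  assumes mor: "morphism_over (proj_points d f) (proj_points e g) \<phi>" and d: "d \<noteq> 0"
    and fg: "Polynomial.degree f = 3" "Polynomial.degree g = 3"
    and orig: "\<And>P. P \<in> proj_points d f \<Longrightarrow> P \<noteq> origin \<Longrightarrow> \<phi> P \<noteq> origin"
  obtains u w where "regular d f u" "regular d f w"
    "\<And>x y. (x, y) \<in> affine_points d f \<Longrightarrow> (u (x, y), w (x, y)) \<in> affine_points e g"
    "\<And>x y. (x, y) \<in> affine_points d f \<Longrightarrow> \<phi> (hcoord (x, y, 1)) = hcoord (u (x, y), w (x, y), 1)"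
    "\<And>Q x y. (\<And>a b :: 'a alg_closure. (a + b) ^ Q = a ^ Q + b ^ Q) \<Longrightarrow> (\<And>a::'a. to_ac a ^ Q = to_ac a) \<Longrightarrow>
      Q > 0 \<Longrightarrow> (x, y) \<in> affine_points d f \<Longrightarrow> (x ^ Q, y ^ Q) \<in> affine_points d f \<Longrightarrow>
      u (x ^ Q, y ^ Q) = u (x, y) ^ Q"
proof -
  let ?C = "affine_points d f"
  note mem = hcoord_affine_mem_proj_points[OF fg(1), of _ _ d]
  have "\<exists>v. v \<in> affine_points e g \<and> \<phi> (hcoord (fst P, snd P, 1)) = hcoord (fst v, snd v, 1)" if "P \<in> ?C" for P
  proof -
    obtain x y where P: "P = (x, y)" by (cases P)
    have "hcoord (x, y, 1) \<in> proj_points d f" using that by (simp add: mem P)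
    moreover have "hcoord (x, y, 1) \<noteq> origin" by (auto simp: origin_def hcoord_eq_iff)
    ultimately have "\<phi> (hcoord (x, y, 1)) \<in> proj_points e g" "\<phi> (hcoord (x, y, 1)) \<noteq> origin"
      using orig mor unfolding morphism_over_def by blast+
    then obtain x' y' where "\<phi> (hcoord (x, y, 1)) = hcoord (x', y', 1)" "(x', y') \<in> affine_points e g"
      by (rule proj_points_affine_cases[OF fg(2)])
    then show ?thesis by (intro exI[of _ "(x', y')"]) (simp add: P)
  qed
  then obtain v where v: "\<And>P. P \<in> ?C \<Longrightarrow> v P \<in> affine_points e g"
    "\<And>P. P \<in> ?C \<Longrightarrow> \<phi> (hcoord (fst P, snd P, 1)) = hcoord (fst (v P), snd (v P), 1)"
    by metis
  have loc: "\<exists>m A\<^sub>0 A\<^sub>1 A\<^sub>2. form_eval m A\<^sub>2 (fst P, snd P, 1) \<noteq> 0 \<and> (\<forall>R\<in>?C.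
      form_eval m A\<^sub>0 (fst R, snd R, 1) = fst (v R) * form_eval m A\<^sub>2 (fst R, snd R, 1) \<and>
      form_eval m A\<^sub>1 (fst R, snd R, 1) = snd (v R) * form_eval m A\<^sub>2 (fst R, snd R, 1))" if P: "P \<in> ?C" for P
  proof -
    obtain x y where xy: "P = (x, y)" by (cases P)
    have "hcoord (x, y, 1) \<in> proj_points d f" using P by (simp add: mem xy)
    moreover have "\<forall>P\<in>proj_points d f. \<exists>m A\<^sub>0 A\<^sub>1 A\<^sub>2.
        (\<exists>t. P = hcoord t \<and> (form_eval m A\<^sub>0 t, form_eval m A\<^sub>1 t, form_eval m A\<^sub>2 t) \<noteq> (0, 0, 0)) \<and>
        (\<forall>t. hcoord t \<in> proj_points d f \<and> (form_eval m A\<^sub>0 t, form_eval m A\<^sub>1 t, form_eval m A\<^sub>2 t) \<noteq> (0, 0, 0) \<longrightarrow>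
          \<phi> (hcoord t) = hcoord (form_eval m A\<^sub>0 t, form_eval m A\<^sub>1 t, form_eval m A\<^sub>2 t))"
      using mor unfolding morphism_over_def Let_def by (rule conjunct2)
    ultimately have "\<exists>m A\<^sub>0 A\<^sub>1 A\<^sub>2.
        (\<exists>t. hcoord (x, y, 1) = hcoord t \<and> (form_eval m A\<^sub>0 t, form_eval m A\<^sub>1 t, form_eval m A\<^sub>2 t) \<noteq> (0, 0, 0)) \<and>
        (\<forall>t. hcoord t \<in> proj_points d f \<and> (form_eval m A\<^sub>0 t, form_eval m A\<^sub>1 t, form_eval m A\<^sub>2 t) \<noteq> (0, 0, 0) \<longrightarrow>
          \<phi> (hcoord t) = hcoord (form_eval m A\<^sub>0 t, form_eval m A\<^sub>1 t, form_eval m A\<^sub>2 t))"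
      by (rule bspec[rotated])
    then obtain m A\<^sub>0 A\<^sub>1 A\<^sub>2 t where t: "hcoord (x, y, 1) = hcoord t"
      "(form_eval m A\<^sub>0 t, form_eval m A\<^sub>1 t, form_eval m A\<^sub>2 t) \<noteq> (0, 0, 0)"
      and ev: "\<And>t. hcoord t \<in> proj_points d f \<Longrightarrow>
        (form_eval m A\<^sub>0 t, form_eval m A\<^sub>1 t, form_eval m A\<^sub>2 t) \<noteq> (0, 0, 0) \<Longrightarrow>
        \<phi> (hcoord t) = hcoord (form_eval m A\<^sub>0 t, form_eval m A\<^sub>1 t, form_eval m A\<^sub>2 t)"
      by (elim exE conjE) (rule that, assumption+, blast)
    obtain t1 t2 t3 where t3: "t = (t1, t2, t3)" by (cases t)
    obtain c where c: "t = (c * x, c * y, c * 1)" using t(1) unfolding t3 hcoord_eq_iff by auto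
    have nz: "(form_eval m A\<^sub>0 (x, y, 1), form_eval m A\<^sub>1 (x, y, 1), form_eval m A\<^sub>2 (x, y, 1)) \<noteq> (0, 0, 0)"
      using t(2) unfolding c form_eval_homogeneous by auto
    \<comment> \<open>Where all three forms vanish the equations are trivial, so they hold on the
      whole affine curve and not only near \<open>P\<close>.\<close>
    have *: "form_eval m A\<^sub>0 (fst R, snd R, 1) = fst (v R) * form_eval m A\<^sub>2 (fst R, snd R, 1) \<and>
      form_eval m A\<^sub>1 (fst R, snd R, 1) = snd (v R) * form_eval m A\<^sub>2 (fst R, snd R, 1)" if R: "R \<in> ?C" for R
    proof (cases "(form_eval m A\<^sub>0 (fst R, snd R, 1), form_eval m A\<^sub>1 (fst R, snd R, 1), form_eval m A\<^sub>2 (fst R, snd R, 1)) = (0, 0, 0)")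
      case True
      then show ?thesis by simp
    next
      case False
      have "hcoord (fst R, snd R, 1) \<in> proj_points d f" using R by (simp add: mem)
      from ev[OF this False] v(2)[OF R] show ?thesis unfolding hcoord_eq_iff by (auto simp: hcoord_eq_iff)
    qed
    \<comment> \<open>If \<open>A\<^sub>2\<close> vanished at \<open>P\<close>, the equations would
      make the other two forms vanish as well.\<close>
    have "form_eval m A\<^sub>2 (x, y, 1) \<noteq> 0" using nz *[OF P] by (auto simp: xy)
    then have "form_eval m A\<^sub>2 (fst P, snd P, 1) \<noteq> 0" by (simp add: xy)
    with * show ?thesis by blast
  qed
  show thesis
  proof (rule that)
    show "regular d f (\<lambda>P. fst (v P))"
    proof (rule locally_regular_imp_regular[OF d])
      fix P assume "P \<in> ?C"
      from loc[OF this] obtain m A\<^sub>0 A\<^sub>1 A\<^sub>2 where "form_eval m A\<^sub>2 (fst P, snd P, 1) \<noteq> 0"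
        "\<forall>R\<in>?C. form_eval m A\<^sub>0 (fst R, snd R, 1) = fst (v R) * form_eval m A\<^sub>2 (fst R, snd R, 1)" by blast
      then show "\<exists>g h. regular d f g \<and> regular d f h \<and> h P \<noteq> 0 \<and> (\<forall>R\<in>?C. g R = fst (v R) * h R)"
        by - (rule exI[where x = "\<lambda>R. form_eval m A\<^sub>0 (fst R, snd R, 1)"],
          rule exI[where x = "\<lambda>R. form_eval m A\<^sub>2 (fst R, snd R, 1)"],
          intro conjI regular_form_eval[OF d])
    qed
    show "regular d f (\<lambda>P. snd (v P))"
    proof (rule locally_regular_imp_regular[OF d])
      fix P assume "P \<in> ?C"
      from loc[OF this] obtain m A\<^sub>0 A\<^sub>1 A\<^sub>2 where "form_eval m A\<^sub>2 (fst P, snd P, 1) \<noteq> 0"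
        "\<forall>R\<in>?C. form_eval m A\<^sub>1 (fst R, snd R, 1) = snd (v R) * form_eval m A\<^sub>2 (fst R, snd R, 1)" by blast
      then show "\<exists>g h. regular d f g \<and> regular d f h \<and> h P \<noteq> 0 \<and> (\<forall>R\<in>?C. g R = snd (v R) * h R)"
        by - (rule exI[where x = "\<lambda>R. form_eval m A\<^sub>1 (fst R, snd R, 1)"],
          rule exI[where x = "\<lambda>R. form_eval m A\<^sub>2 (fst R, snd R, 1)"],
          intro conjI regular_form_eval[OF d])
    qed
    fix x y assume xy: "(x, y) \<in> ?C"
    show "(fst (v (x, y)), snd (v (x, y))) \<in> affine_points e g" using v(1)[OF xy] by simp
    show "\<phi> (hcoord (x, y, 1)) = hcoord (fst (v (x, y)), snd (v (x, y)), 1)" using v(2)[OF xy] by simp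
  next
    fix Q x y
    assume Q: "\<And>a b :: 'a alg_closure. (a + b) ^ Q = a ^ Q + b ^ Q" "\<And>a::'a. to_ac a ^ Q = to_ac a" "Q > 0"
      and xy: "(x, y) \<in> ?C" "(x ^ Q, y ^ Q) \<in> ?C"
    obtain m A\<^sub>0 A\<^sub>1 A\<^sub>2 where A: "form_eval m A\<^sub>2 (x, y, 1) \<noteq> 0"
      "\<And>R. R \<in> ?C \<Longrightarrow> form_eval m A\<^sub>0 (fst R, snd R, 1) = fst (v R) * form_eval m A\<^sub>2 (fst R, snd R, 1)"
      using loc[OF xy(1)] by auto
    have pw: "form_eval m A' (x ^ Q, y ^ Q, 1) = form_eval m A' (x, y, 1) ^ Q" for A'
      using form_eval_power[OF Q, of m A' x y 1] by simp
    have "fst (v (x ^ Q, y ^ Q)) * form_eval m A\<^sub>2 (x, y, 1) ^ Q = (fst (v (x, y)) * form_eval m A\<^sub>2 (x, y, 1)) ^ Q"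
      using A(2)[OF xy(1)] A(2)[OF xy(2)] by (simp add: pw)
    then show "fst (v (x ^ Q, y ^ Q)) = fst (v (x, y)) ^ Q" using A(1) by (simp add: power_mult_distrib)
  qed
qed

section \<open>Descent to the finite field by Frobenius\<close>

lemma poly_map_to_ac_power:
  fixes f :: "'a::field poly"
  assumes "\<And>a b :: 'a alg_closure. (a + b) ^ Q = a ^ Q + b ^ Q" "\<And>a::'a. to_ac a ^ Q = to_ac a" "Q > 0"
  shows "poly (map_poly to_ac f) (x ^ Q) = poly (map_poly to_ac f) x ^ Q"
  by (induction f) (simp_all add: map_poly_pCons assms power_mult_distrib)

text \<open>The polynomial \<open>?h\<close> has at most \<open>CARD('a)\<close> roots, and the
  images of the field elements already supply that many.\<close>

lemma power_CARD_eq_self_imp_range_to_ac: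
  fixes x :: "'a::{field,finite} alg_closure"
  assumes "x ^ CARD('a) = x"
  shows "x \<in> range to_ac"
proof -
  let ?Q = "CARD('a)"
  let ?h = "Polynomial.monom 1 ?Q - Polynomial.monom 1 1 :: 'a alg_closure poly"
  let ?R = "{x. poly ?h x = 0}"
  have "card {0, 1::'a} \<le> ?Q" by (intro card_mono) auto
  then have Q: "?Q > 1" by simp
  have deg: "Polynomial.degree ?h = ?Q"
    using Q unfolding diff_conv_add_uminus by (subst degree_add_eq_left) (simp_all add: degree_monom_eq)
  have h0: "?h \<noteq> 0"
  proof
    assume "?h = 0"
    then have "Polynomial.degree ?h = 0" by (simp only: degree_0)
    then show False using Q unfolding deg by simp
  qed
  have "range to_ac \<subseteq> ?R"
  proof clarify
    fix a :: 'a
    have "to_ac a ^ ?Q = to_ac a" by (simp only: to_ac_power[symmetric] power_CARD_eq_self)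
    then show "poly ?h (to_ac a) = 0" by (simp add: poly_monom)
  qed
  moreover have "finite ?R" using h0 by (rule poly_roots_finite)
  moreover have "card ?R \<le> card (range (to_ac :: 'a \<Rightarrow> _))"
    using card_poly_roots_bound[OF h0] unfolding deg by (simp add: card_image[OF inj_to_ac])
  ultimately have "range to_ac = ?R" by (intro card_seteq) auto
  then show ?thesis using assms by (simp add: poly_monom)
qed

text \<open>The inverse morphism writes \<open>x\<close> and \<open>y\<close> as polynomials in
  \<open>u\<close> and \<open>w\<close>, as \<open>generating_coordinates_affine\<close> requires;
  Frobenius then brings the resulting \<open>\<alpha>\<close> and \<open>\<beta>\<close> down to the
  base field.\<close>

lemma isomorphic_imp_twist:
  fixes f :: "'a::{field,finite} poly"
  assumes p: "Factorial_Ring.prime p" "CHAR('a) = p" "CARD('a) = p ^ r" and two: "(2::'a) \<noteq> 0"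
    and f: "Polynomial.degree f = 3" and a: "a \<noteq> 0"
    and iso: "isomorphic_over 1 f a (Polynomial.monom 1 3 - Polynomial.monom 1 1)"
  shows "\<exists>c \<alpha> \<beta>. c \<noteq> 0 \<and> \<alpha> \<noteq> 0 \<and> f = smult c ([:\<beta>, \<alpha>:] ^ 3 - [:\<beta>, \<alpha>:])"
proof -
  define f' where "f' = map_poly to_ac f"
  define g' where "g' = map_poly to_ac (Polynomial.monom 1 3 - Polynomial.monom 1 1 :: 'a poly)"
  define e where "e = to_ac a"
  have e: "e \<noteq> 0" using a by (simp add: e_def)
  have two': "(2::'a alg_closure) \<noteq> 0"
  proof -
    have "to_ac (2::'a) \<noteq> 0" using two by (simp only: to_ac_eq_0_iff not_False_eq_True)
    then show ?thesis by simp
  qed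
  have f': "Polynomial.degree f' = 3" using f by (simp add: f'_def degree_map_poly)
  have g: "(Polynomial.monom 1 3 - Polynomial.monom 1 1 :: 'a poly) = [:0, - 1, 0, 1:]"
    by (simp add: monom_altdef power3_eq_cube)
  have poly_g': "poly g' x = x ^ 3 - x" for x
    unfolding g'_def g by (simp add: map_poly_pCons power3_eq_cube algebra_simps)
  have g': "Polynomial.degree g' = 3"
    unfolding g'_def g by (simp add: degree_map_poly)
  let ?C = "proj_points 1 f'" and ?D = "proj_points e g'"
  obtain \<phi> \<psi> where \<phi>: "morphism_over ?C ?D \<phi>" and \<psi>: "morphism_over ?D ?C \<psi>"
    and inv: "\<forall>P\<in>?C. \<psi> (\<phi> P) = P" "\<forall>R\<in>?D. \<phi> (\<psi> R) = R" and orig: "\<phi> origin = origin"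
    using iso unfolding isomorphic_over_def Let_def to_ac_1 f'_def[symmetric] g'_def[symmetric] e_def[symmetric]
    by (elim exE conjE) (rule that)
  have "origin \<in> ?C" unfolding origin_def hcoord_mem_proj_points by (simp add: eval_nat_numeral)
  then have orig': "\<psi> origin = origin" using inv(1) orig by metis
  obtain u w where u: "regular 1 f' u" "regular 1 f' w"
    "\<And>x y. (x, y) \<in> affine_points 1 f' \<Longrightarrow> (u (x, y), w (x, y)) \<in> affine_points e g'"
    "\<And>x y. (x, y) \<in> affine_points 1 f' \<Longrightarrow> \<phi> (hcoord (x, y, 1)) = hcoord (u (x, y), w (x, y), 1)"
    "\<And>Q x y. (\<And>a b :: 'a alg_closure. (a + b) ^ Q = a ^ Q + b ^ Q) \<Longrightarrow> (\<And>a::'a. to_ac a ^ Q = to_ac a) \<Longrightarrow>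
      Q > 0 \<Longrightarrow> (x, y) \<in> affine_points 1 f' \<Longrightarrow> (x ^ Q, y ^ Q) \<in> affine_points 1 f' \<Longrightarrow>
      u (x ^ Q, y ^ Q) = u (x, y) ^ Q"
  proof (rule morphism_coordinates[OF \<phi> _ f' g'])
    show "\<phi> P \<noteq> origin" if "P \<in> ?C" "P \<noteq> origin" for P using that inv(1) orig' by metis
  qed auto
  obtain u' w' where u': "regular e g' u'" "regular e g' w'"
    "\<And>x y. (x, y) \<in> affine_points e g' \<Longrightarrow> \<psi> (hcoord (x, y, 1)) = hcoord (u' (x, y), w' (x, y), 1)"
  proof (rule morphism_coordinates[OF \<psi> e g' f'])
    show "\<psi> P \<noteq> origin" if "P \<in> ?D" "P \<noteq> origin" for P using that inv(2) orig by metis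
  qed auto
  obtain A B where AB: "\<And>x y. e * y\<^sup>2 = poly g' x \<Longrightarrow> u' (x, y) = poly A x + poly B x * y"
    using regularE[OF u'(1)] by blast
  obtain A' B' where AB': "\<And>x y. e * y\<^sup>2 = poly g' x \<Longrightarrow> w' (x, y) = poly A' x + poly B' x * y"
    using regularE[OF u'(2)] by blast
  have on_D: "e * (w (x, y))\<^sup>2 = poly g' (u (x, y))" if "y\<^sup>2 = poly f' x" for x y
    using u(3)[of x y] that by (simp add: affine_points_def)
  have inv_x: "u' (u (x, y), w (x, y)) = x \<and> w' (u (x, y), w (x, y)) = y" if "y\<^sup>2 = poly f' x" for x y
  proof -
    have xy: "(x, y) \<in> affine_points 1 f'" using that by (simp add: affine_points_def)
    then have "hcoord (x, y, 1) \<in> ?C" by (simp add: hcoord_affine_mem_proj_points[OF f'])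
    from bspec[OF inv(1) this] have "hcoord (u' (u (x, y), w (x, y)), w' (u (x, y), w (x, y)), 1) = hcoord (x, y, 1)"
      unfolding u(4)[OF xy] u'(3)[OF u(3)[OF xy]] .
    then show ?thesis unfolding hcoord_eq_iff by auto
  qed
  have "\<exists>\<alpha> \<beta> \<kappa>. \<alpha> \<noteq> 0 \<and> \<kappa> \<noteq> 0 \<and> (\<forall>x y. y\<^sup>2 = poly f' x \<longrightarrow> u (x, y) = \<alpha> * x + \<beta>) \<and>
    (\<forall>x. \<kappa> * poly f' x = (\<alpha> * x + \<beta>) ^ 3 - (\<alpha> * x + \<beta>))"
  proof (rule generating_coordinates_affine[OF f' two' e u(1,2)])
    fix x y assume y: "y\<^sup>2 = poly f' x"
    show "e * (w (x, y))\<^sup>2 = u (x, y) ^ 3 - u (x, y)" using on_D[OF y] by (simp add: poly_g')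
    show "x = poly A (u (x, y)) + poly B (u (x, y)) * w (x, y)"
      using inv_x[OF y] AB[OF on_D[OF y]] by simp
    show "y = poly A' (u (x, y)) + poly B' (u (x, y)) * w (x, y)"
      using inv_x[OF y] AB'[OF on_D[OF y]] by simp
  qed
  then obtain \<alpha> \<beta> \<kappa> where \<alpha>: "\<alpha> \<noteq> 0" "\<kappa> \<noteq> 0" "\<And>x y. y\<^sup>2 = poly f' x \<Longrightarrow> u (x, y) = \<alpha> * x + \<beta>"
    "\<And>x. \<kappa> * poly f' x = (\<alpha> * x + \<beta>) ^ 3 - (\<alpha> * x + \<beta>)" by blast
  define Q where "Q = CARD('a)"
  have Frob: "(a + b) ^ Q = a ^ Q + b ^ Q" for a b :: "'a alg_closure"
    by (rule freshmans_dream') (simp_all add: p Q_def)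
  have Frob_fix: "to_ac a ^ Q = to_ac a" for a :: 'a
    unfolding Q_def by (simp only: to_ac_power[symmetric] power_CARD_eq_self)
  have Q0: "Q > 0" by (simp add: Q_def finite_UNIV_card_ge_0)
  \<comment> \<open>Every \<open>x\<close> lies below a point of the curve, whose Frobenius image is
    on the curve again because \<open>f\<close> has coefficients in the base field.\<close>
  have comm: "\<alpha> * x ^ Q + \<beta> = (\<alpha> * x + \<beta>) ^ Q" for x
  proof -
    obtain y where y: "y\<^sup>2 = poly f' x" using exists_snd[of 1 f' x] by auto
    have "(y ^ Q)\<^sup>2 = (y\<^sup>2) ^ Q" by (simp add: mult.commute flip: power_mult)
    also have "\<dots> = poly f' (x ^ Q)"
      unfolding y f'_def by (rule poly_map_to_ac_power[OF Frob Frob_fix Q0, symmetric])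
    finally have yQ: "(y ^ Q)\<^sup>2 = poly f' (x ^ Q)" .
    have "u (x ^ Q, y ^ Q) = u (x, y) ^ Q"
      using y yQ by (intro u(5)[OF Frob Frob_fix Q0]) (simp_all add: affine_points_def)
    then show ?thesis by (simp add: \<alpha>(3)[OF y] \<alpha>(3)[OF yQ])
  qed
  have \<beta>Q: "\<beta> ^ Q = \<beta>" using comm[of 0] Q0 by (simp add: power_0_left)
  have "\<alpha> ^ Q = \<alpha>" using comm[of 1] by (simp add: Frob \<beta>Q)
  then obtain \<alpha>\<^sub>0 where \<alpha>0: "\<alpha> = to_ac \<alpha>\<^sub>0" using power_CARD_eq_self_imp_range_to_ac unfolding Q_def by blast
  obtain \<beta>\<^sub>0 where \<beta>0: "\<beta> = to_ac \<beta>\<^sub>0" using \<beta>Q power_CARD_eq_self_imp_range_to_ac unfolding Q_def by blast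
  define v where "v = [:\<beta> ^ 3 - \<beta>, 3 * \<alpha> * \<beta>\<^sup>2 - \<alpha>, 3 * \<alpha>\<^sup>2 * \<beta>, \<alpha> ^ 3:]"
  have \<kappa>: "smult \<kappa> f' = v"
    by (rule poly_eqI_alg_closed) (simp add: \<alpha>(4) v_def power2_eq_square power3_eq_cube algebra_simps)
  \<comment> \<open>By comparison of leading coefficients this is the inverse of
    \<open>\<kappa>\<close>, now visibly in the base field.\<close>
  define c where "c = Polynomial.coeff f 3 / \<alpha>\<^sub>0 ^ 3"
  have lc: "Polynomial.coeff f 3 \<noteq> 0" using f leading_coeff_0_iff[of f] by auto
  have \<alpha>00: "\<alpha>\<^sub>0 \<noteq> 0" using \<alpha>(1) \<alpha>0 by auto
  have c: "c \<noteq> 0" using lc \<alpha>00 by (simp add: c_def)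
  have "\<kappa> * to_ac (Polynomial.coeff f 3) = to_ac \<alpha>\<^sub>0 ^ 3"
    using arg_cong[OF \<kappa>, of "\<lambda>h. Polynomial.coeff h 3"]
    by (simp add: f'_def coeff_map_poly v_def \<alpha>0 numeral_3_eq_3)
  then have c\<kappa>: "to_ac c * \<kappa> = 1" using \<alpha>00 by (simp add: c_def field_simps)
  have "f' = smult (to_ac c) v" using \<kappa> c\<kappa> by (metis smult_smult smult_1_left)
  also have "\<dots> = map_poly to_ac (smult c ([:\<beta>\<^sub>0, \<alpha>\<^sub>0:] ^ 3 - [:\<beta>\<^sub>0, \<alpha>\<^sub>0:]))"
  proof -
    have "smult c ([:\<beta>\<^sub>0, \<alpha>\<^sub>0:] ^ 3 - [:\<beta>\<^sub>0, \<alpha>\<^sub>0:])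
        = smult c [:\<beta>\<^sub>0 ^ 3 - \<beta>\<^sub>0, 3 * \<alpha>\<^sub>0 * \<beta>\<^sub>0\<^sup>2 - \<alpha>\<^sub>0, 3 * \<alpha>\<^sub>0\<^sup>2 * \<beta>\<^sub>0, \<alpha>\<^sub>0 ^ 3:]"
      by (simp add: power2_eq_square power3_eq_cube algebra_simps)
    then show ?thesis by (simp add: v_def \<alpha>0 \<beta>0 map_poly_pCons)
  qed
  finally have "f = smult c ([:\<beta>\<^sub>0, \<alpha>\<^sub>0:] ^ 3 - [:\<beta>\<^sub>0, \<alpha>\<^sub>0:])"
    unfolding f'_def by (intro poly_eqI) (metis coeff_map_poly to_ac_0 to_ac_eq_iff)
  then show ?thesis using c \<alpha>00 by blast
qed

theorem theorem1p14:
  fixes p q k n :: nat and f :: "'a::{field,finite} poly"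
  assumes "Factorial_Ring.prime p" and "odd p" and "k \<ge> 1" and "q = p ^ k"
    and "n \<ge> 1"
    and "CARD('a) = q ^ n"
    and "Polynomial.degree f = 3"
    and "rsquarefree (map_poly to_ac f)"
  shows "(\<exists>F G :: 'a poly.
            (to_fract F, to_fract G) \<in>
              affine_points (to_fract (Polynomial.monom 1 (q ^ n) - Polynomial.monom 1 1))
                (map_poly const_fract f)
            \<and> pderiv F \<noteq> 0 \<and> 2 * Polynomial.degree F \<le> q ^ n - 1)
         \<longleftrightarrow>
         ([p = 3] (mod 4) \<and>
          (\<exists>a :: 'a. a \<noteq> 0 \<and> isomorphic_over 1 f a (Polynomial.monom 1 3 - Polynomial.monom 1 1)))"
    (is "?solution \<longleftrightarrow> ?curve")
proof -
  have card: "CARD('a) = p ^ (k * n)" "k * n \<ge> 1" using assms(3-6) by (simp_all add: power_mult)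
  have char: "CHAR('a) = p" by (rule CHAR_eq_of_CARD_prime_power[OF assms(1) card(1)])
  have two: "(2::'a) \<noteq> 0"
  proof
    assume "(2::'a) = 0"
    then have "of_nat 2 = (0::'a)" by simp
    then have "p dvd 2" unfolding of_nat_eq_0_iff_char_dvd char .
    then show False using assms(1,2) primes_dvd_imp_eq[of p 2] by auto
  qed
  \<comment> \<open>As \<open>to_fract\<close> is injective, the equation over the function field is
    one between polynomials.\<close>
  have fract: "(to_fract F, to_fract G) \<in>
      affine_points (to_fract (Polynomial.monom 1 (q ^ n) - Polynomial.monom 1 1)) (map_poly const_fract f)
    \<longleftrightarrow> (Polynomial.monom 1 CARD('a) - Polynomial.monom 1 1) * G\<^sup>2 = pcompose f F" for F G :: "'a poly"
    by (simp only: affine_points_def mem_Collect_eq prod.case poly_map_const_fract assms(6) power2_eq_square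
        to_fract_mult[symmetric] to_fract_eq_iff)
  show ?thesis
  proof
    assume ?solution
    then obtain F G where FG: "(Polynomial.monom 1 CARD('a) - Polynomial.monom 1 1) * G\<^sup>2 = pcompose f F"
      "pderiv F \<noteq> 0" "2 * Polynomial.degree F \<le> CARD('a) - 1"
      unfolding fract unfolding assms(6)[symmetric] by blast
    have "2 * Polynomial.degree F < CARD('a)" using FG(3) by (simp add: le_less_trans finite_UNIV_card_ge_0)
    from solution_imp_twist[OF assms(1,2) card assms(7) FG(1,2) this] show ?curve
      using twist_imp_isomorphic by blast
  next
    assume ?curve
    then obtain a where a: "p mod 4 = 3" "a \<noteq> 0"
      "isomorphic_over 1 f a (Polynomial.monom 1 3 - Polynomial.monom 1 1)" by (auto simp: cong_def)
    obtain c \<alpha> \<beta> where "f = smult c ([:\<beta>, \<alpha>:] ^ 3 - [:\<beta>, \<alpha>:])" "c \<noteq> 0" "\<alpha> \<noteq> 0"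
      using isomorphic_imp_twist[OF assms(1) char card(1) two assms(7) a(2,3)] by blast
    from twist_imp_solution[OF assms(1) a(1) char card this]
    show ?solution unfolding fract unfolding assms(6)[symmetric] .
  qed
qed

end
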